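(* With the gradation $H=\bigoplus_{k\ge 0}H_k$ induced by the degree of words, $H$ is a graded, connected Hopf algebra; that is, $H_0=\mathbb{K}$, the product is homogeneous, and for all $n\ge 0$, $\Delta(H_n)\subseteq\bigoplus_{i+j=n}H_i\otimes H_j$.
   Context: $\mathbb{K}$ is a field of characteristic zero. $\mathbb{K}\langle\langle x_0,x_1\rangle\rangle$ is the space of noncommutative formal series in $x_0,x_1$, with its usual ultrametric topology; it is an algebra for concatenation and for the shuffle product $\sqcup\!\sqcup$ (determined by $\emptyset\sqcup\!\sqcup w=w\sqcup\!\sqcup\emptyset=w$ and $au\sqcup\!\sqcup bv=a(u\sqcup\!\sqcup bv)+b(au\sqcup\!\sqcup v)$ for letters $a,b$ and words $u,v,w$, extended bilinearly and continuously). $\emptyset$ is the empty word. For $d\in\mathbb{K}\langle\langle x_0,x_1\rangle\rangle$, $\varphi_d$ is the continuous algebra map (for concatenation) from $\mathbb{K}\langle\langle x_0,x_1\rangle\rangle$ to $\mathrm{End}(\mathbb{K}\langle\langle x_0,x_1\rangle\rangle)$ such that $\varphi_d(x_0)(X)=x_0X$ and $\varphi_d(x_1)(X)=x_1X+x_0(d\sqcup\!\sqcup X)$ for all $X$. The composition $c\circ d=\varphi_d(c)(\emptyset)+d$ is associative. For a word $c$, $X_c$ is the linear form on $\mathbb{K}\langle\langle x_0,x_1\rangle\rangle$ giving the coefficient of $c$; $V$ is the span of all the $X_c$, and $H=S(V)$ is the free commutative algebra on the $X_c$'s. Elements of $H$ (resp. $H\otimes H$) are seen as polynomial functions on $\mathbb{K}\langle\langle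 x_0,x_1\rangle\rangle$ (resp. on its square). $\Delta:H\to H\otimes H$ is the algebra morphism such that $\Delta(X_c)(f,g)=X_c(f\circ g)$ for every word $c$ and all series $f,g$; it makes $H$ a bialgebra. The degree of a word $c=c_1\ldots c_n$ is $\deg(c)=n+1+\sharp\{i\in\{1,\ldots,n\}\mid c_i=x_0\}$. For $k\ge1$, $V_k=\mathrm{Vect}(X_c\mid \deg(c)=k)$, so $V=\bigoplus_{k\ge1}V_k$; this induces the gradation $H=\bigoplus_{k\ge0}H_k$ of the algebra $H=S(V)$. *)

theory Defs
  imports
    "HOL.Vector_Spaces"
    "HOL-Library.Poly_Mapping"
    "HOL-Library.Product_Plus"
    "HOL-Library.Groups_Big_Fun"
    "HOL-Library.Multiset"
begin

section \<open>Series in two noncommuting variables and their composition\<close>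

datatype letter = x0 | x1

type_synonym word = "letter list"
type_synonym 'k series = "word \<Rightarrow> 'k"

definition one_series :: "'k::zero_neq_one series" where
  "one_series u = (if u = [] then 1 else 0)"

definition lmult :: "letter \<Rightarrow> 'k::zero series \<Rightarrow> 'k series" where
  "lmult a f u = (case u of [] \<Rightarrow> 0 | b # v \<Rightarrow> if b = a then f v else 0)"

fun shuffle_words :: "word \<Rightarrow> word \<Rightarrow> word multiset" where
  "shuffle_words [] w = {#w#}"
| "shuffle_words w [] = {#w#}"
| "shuffle_words (a # u) (b # v) =
     image_mset ((#) a) (shuffle_words u (b # v)) + image_mset ((#) b) (shuffle_words (a # u) v)"

definition shuffle :: "'k::comm_semiring_1 series \<Rightarrow> 'k series \<Rightarrow> 'k series" where
  "shuffle f g w = (\<Sum>(u, v). f u * g v * of_nat (count (shuffle_words u v) w))"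

definition phi_letter :: "'k::comm_semiring_1 series \<Rightarrow> letter \<Rightarrow> 'k series \<Rightarrow> 'k series" where
  "phi_letter d a X =
     (case a of
        x0 \<Rightarrow> lmult x0 X
      | x1 \<Rightarrow> (\<lambda>u. lmult x1 X u + lmult x0 (shuffle d X) u))"

fun phi_word :: "'k::comm_semiring_1 series \<Rightarrow> word \<Rightarrow> 'k series \<Rightarrow> 'k series" where
  "phi_word d [] X = X"
| "phi_word d (a # w) X = phi_letter d a (phi_word d w X)"

text \<open>
  Every letter acts by an operator that raises the valuation by at least one, so for each \<open>u\<close>
  only the finitely many words \<open>w\<close> with \<open>length w \<le> length u\<close> contribute to the sum
  (lemma \<open>phi_word_eq_0\<close> below): this is the continuous extension of \<open>phi_word\<close> to series.
\<close>

definition phi :: "'k::comm_semiring_1 series \<Rightarrow> 'k series \<Rightarrow> 'k series \<Rightarrow> 'k series" where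
  "phi d c X u = (\<Sum>w. c w * phi_word d w X u)"

definition compose :: "'k::comm_semiring_1 series \<Rightarrow> 'k series \<Rightarrow> 'k series" where
  "compose c d u = phi d c one_series u + d u"


section \<open>Hopf algebra structures on a monoid algebra\<close>

text \<open>
  \<open>'m \<Rightarrow>\<^sub>0 'k\<close> is the vector space with basis \<open>'m\<close>, and the monoid algebra if \<open>'m\<close> is a monoid.
  The tensor product of \<open>'m \<Rightarrow>\<^sub>0 'k\<close> and \<open>'n \<Rightarrow>\<^sub>0 'k\<close> is realised as \<open>'m \<times> 'n \<Rightarrow>\<^sub>0 'k\<close>,
  the basis element \<open>(m, n)\<close> standing for the tensor product of \<open>m\<close> and \<open>n\<close>; for monoids,
  the monoid algebra of the product monoid carries the usual product of tensors.
\<close>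

abbreviation "lookup \<equiv> Poly_Mapping.lookup"
abbreviation "keys \<equiv> Poly_Mapping.keys"

definition smult :: "'k::semiring_0 \<Rightarrow> ('m \<Rightarrow>\<^sub>0 'k) \<Rightarrow> ('m \<Rightarrow>\<^sub>0 'k)" where
  "smult a = Poly_Mapping.map ((*) a)"

lemma lookup_smult [simp]: "lookup (smult a p) m = a * lookup p m"
  by (auto simp: smult_def Poly_Mapping.map.rep_eq when_def)

global_interpretation pm: vector_space "smult :: 'k::field \<Rightarrow> ('m \<Rightarrow>\<^sub>0 'k) \<Rightarrow> _"
  by unfold_locales (auto intro!: poly_mapping_eqI simp: lookup_add algebra_simps)

definition lin_ext :: "('k::zero \<Rightarrow> 'a \<Rightarrow> 'a::comm_monoid_add) \<Rightarrow> ('m \<Rightarrow> 'a) \<Rightarrow> ('m \<Rightarrow>\<^sub>0 'k) \<Rightarrow> 'a" where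
  "lin_ext sc h p = (\<Sum>m\<in>keys p. sc (lookup p m) (h m))"

definition algebra_hom ::
  "('k \<Rightarrow> 'a \<Rightarrow> 'a) \<Rightarrow> (('m::comm_monoid_add \<Rightarrow>\<^sub>0 'k::field) \<Rightarrow> 'a::comm_ring_1) \<Rightarrow> bool" where
  "algebra_hom sc f \<longleftrightarrow>
     Vector_Spaces.linear smult sc f \<and> f 1 = 1 \<and> (\<forall>p q. f (p * q) = f p * f q)"

definition tensor :: "('m \<Rightarrow>\<^sub>0 'k::field) \<Rightarrow> ('n \<Rightarrow>\<^sub>0 'k) \<Rightarrow> ('m \<times> 'n \<Rightarrow>\<^sub>0 'k)" where
  "tensor p q = lin_ext smult (\<lambda>m. lin_ext smult (\<lambda>n. Poly_Mapping.single (m, n) 1) q) p"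

definition tensor_map ::
  "(('m \<Rightarrow>\<^sub>0 'k::field) \<Rightarrow> ('r \<Rightarrow>\<^sub>0 'k)) \<Rightarrow> (('n \<Rightarrow>\<^sub>0 'k) \<Rightarrow> ('s \<Rightarrow>\<^sub>0 'k)) \<Rightarrow>
   ('m \<times> 'n \<Rightarrow>\<^sub>0 'k) \<Rightarrow> ('r \<times> 's \<Rightarrow>\<^sub>0 'k)" where
  "tensor_map f g =
     lin_ext smult (\<lambda>(m, n). tensor (f (Poly_Mapping.single m 1)) (g (Poly_Mapping.single n 1)))"

definition tensor_assoc :: "(('m \<times> 'n) \<times> 'r \<Rightarrow>\<^sub>0 'k::field) \<Rightarrow> ('m \<times> 'n \<times> 'r \<Rightarrow>\<^sub>0 'k)" where
  "tensor_assoc = Poly_Mapping.map_key (\<lambda>(m, n, r). ((m, n), r))"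

definition mult_map :: "('m \<times> 'm \<Rightarrow>\<^sub>0 'k::field) \<Rightarrow> ('m::comm_monoid_add \<Rightarrow>\<^sub>0 'k)" where
  "mult_map = lin_ext smult (\<lambda>(m, n). Poly_Mapping.single m 1 * Poly_Mapping.single n 1)"

definition coassociative :: "(('m \<Rightarrow>\<^sub>0 'k::field) \<Rightarrow> ('m \<times> 'm \<Rightarrow>\<^sub>0 'k)) \<Rightarrow> bool" where
  "coassociative \<Delta> \<longleftrightarrow>
     (\<forall>p. tensor_assoc (tensor_map \<Delta> id (\<Delta> p)) = tensor_map id \<Delta> (\<Delta> p))"

text \<open>The target \<open>K \<otimes> H\<close> of \<open>\<epsilon> \<otimes> id\<close> is identified with \<open>H\<close>, and so is \<open>H \<otimes> K\<close>.\<close>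

definition is_counit ::
  "(('m \<Rightarrow>\<^sub>0 'k::field) \<Rightarrow> ('m \<times> 'm \<Rightarrow>\<^sub>0 'k)) \<Rightarrow> (('m \<Rightarrow>\<^sub>0 'k) \<Rightarrow> 'k) \<Rightarrow> bool" where
  "is_counit \<Delta> \<epsilon> \<longleftrightarrow>
     (\<forall>p. lin_ext smult (\<lambda>(m, n). smult (\<epsilon> (Poly_Mapping.single m 1)) (Poly_Mapping.single n 1)) (\<Delta> p) = p) \<and>
     (\<forall>p. lin_ext smult (\<lambda>(m, n). smult (\<epsilon> (Poly_Mapping.single n 1)) (Poly_Mapping.single m 1)) (\<Delta> p) = p)"

definition is_antipode ::
  "(('m::comm_monoid_add \<Rightarrow>\<^sub>0 'k::field) \<Rightarrow> ('m \<times> 'm \<Rightarrow>\<^sub>0 'k)) \<Rightarrow> (('m \<Rightarrow>\<^sub>0 'k) \<Rightarrow> 'k) \<Rightarrow>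
   (('m \<Rightarrow>\<^sub>0 'k) \<Rightarrow> ('m \<Rightarrow>\<^sub>0 'k)) \<Rightarrow> bool" where
  "is_antipode \<Delta> \<epsilon> S \<longleftrightarrow> Vector_Spaces.linear smult smult S \<and>
     (\<forall>p. mult_map (tensor_map S id (\<Delta> p)) = smult (\<epsilon> p) 1) \<and>
     (\<forall>p. mult_map (tensor_map id S (\<Delta> p)) = smult (\<epsilon> p) 1)"

definition hopf_algebra :: "(('m::comm_monoid_add \<Rightarrow>\<^sub>0 'k::field) \<Rightarrow> ('m \<times> 'm \<Rightarrow>\<^sub>0 'k)) \<Rightarrow> bool" where
  "hopf_algebra \<Delta> \<longleftrightarrow> algebra_hom smult \<Delta> \<and> coassociative \<Delta> \<and>
     (\<exists>\<epsilon>. algebra_hom (*) \<epsilon> \<and> is_counit \<Delta> \<epsilon> \<and> (\<exists>S. is_antipode \<Delta> \<epsilon> S))"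

definition direct_sum_decomposition :: "(nat \<Rightarrow> ('m \<Rightarrow>\<^sub>0 'k::field) set) \<Rightarrow> bool" where
  "direct_sum_decomposition G \<longleftrightarrow> (\<forall>n. pm.subspace (G n)) \<and>
     (\<forall>p. \<exists>!g. (\<forall>n. g n \<in> G n) \<and> finite {n. g n \<noteq> 0} \<and> p = (\<Sum>n. g n))"

text \<open>
  The degree \<open>n\<close> part of the tensor square. It is the sum of the subspaces \<open>G i \<otimes> G j\<close> with
  \<open>i + j = n\<close>; this sum is automatically direct if \<open>G\<close> is a direct sum decomposition.
\<close>

definition tensor_grade :: "(nat \<Rightarrow> ('m \<Rightarrow>\<^sub>0 'k::field) set) \<Rightarrow> nat \<Rightarrow> ('m \<times> 'm \<Rightarrow>\<^sub>0 'k) set" where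
  "tensor_grade G n = pm.span {tensor p q |p q i j. i + j = n \<and> p \<in> G i \<and> q \<in> G j}"


section \<open>The algebra of polynomial functions on series\<close>

text \<open>
  The free commutative algebra on the coordinates is the algebra of polynomials in
  indeterminates indexed by words; monomials are finitely supported exponents.
\<close>

type_synonym mon = "word \<Rightarrow>\<^sub>0 nat"
type_synonym 'k H = "mon \<Rightarrow>\<^sub>0 'k"
type_synonym 'k HH = "mon \<times> mon \<Rightarrow>\<^sub>0 'k"

definition coord :: "word \<Rightarrow> 'k::field H" where
  "coord c = Poly_Mapping.single (Poly_Mapping.single c 1) 1"

definition mon_eval :: "(word \<Rightarrow> 'a::comm_monoid_mult) \<Rightarrow> mon \<Rightarrow> 'a" where
  "mon_eval f m = (\<Prod>c\<in>keys m. f c ^ lookup m c)"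

definition poly_fun :: "'k::field H \<Rightarrow> 'k series \<Rightarrow> 'k" where
  "poly_fun p f = lin_ext (*) (mon_eval f) p"

definition poly_fun2 :: "'k::field HH \<Rightarrow> 'k series \<Rightarrow> 'k series \<Rightarrow> 'k" where
  "poly_fun2 P f g = lin_ext (*) (\<lambda>(m, n). mon_eval f m * mon_eval g n) P"

definition is_coproduct :: "('k::field H \<Rightarrow> 'k HH) \<Rightarrow> bool" where
  "is_coproduct \<Delta> \<longleftrightarrow> algebra_hom smult \<Delta> \<and>
     (\<forall>c f g. poly_fun2 (\<Delta> (coord c)) f g = poly_fun (coord c) (compose f g))"

text \<open>Existence and uniqueness over fields of characteristic zero is lemma \<open>ex1_coproduct\<close> below.\<close>

definition coproduct :: "'k::field H \<Rightarrow> 'k HH" where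
  "coproduct = (THE \<Delta>. is_coproduct \<Delta>)"

definition deg :: "word \<Rightarrow> nat" where
  "deg c = length c + 1 + card {i. i < length c \<and> c ! i = x0}"

definition V_grade :: "nat \<Rightarrow> 'k::field H set" where
  "V_grade k = pm.span {coord c |c. deg c = k}"

definition H_grade :: "nat \<Rightarrow> 'k::field H set" where
  "H_grade n = pm.span {prod_list vs |vs ks. list_all2 (\<lambda>v k. 1 \<le> k \<and> v \<in> V_grade k) vs ks \<and> sum_list ks = n}"


section \<open>Well-definedness of the coproduct\<close>

lemma lin_ext_superset:
  assumes "vector_space sc" "finite A" "keys p \<subseteq> A"
  shows "lin_ext sc h p = (\<Sum>m\<in>A. sc (lookup p m) (h m))"
proof -
  interpret vector_space sc by fact
  show ?thesis unfolding lin_ext_def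
    by (rule sum.mono_neutral_left) (use assms in \<open>auto simp: in_keys_iff\<close>)
qed

lemma linear_lin_ext:
  assumes "vector_space sc"
  shows "Vector_Spaces.linear smult sc (lin_ext sc h)"
proof -
  interpret vector_space sc by fact
  have *: "lin_ext sc h (p + q) = lin_ext sc h p + lin_ext sc h q" for p q
  proof -
    have "lin_ext sc h r = (\<Sum>m\<in>keys p \<union> keys q. sc (lookup r m) (h m))" if "r \<in> {p, q, p + q}" for r
      by (rule lin_ext_superset[OF assms]) (use that keys_add[of p q] in auto)
    then show ?thesis
      by (simp add: lookup_add scale_left_distrib sum.distrib)
  qed
  have **: "lin_ext sc h (smult a p) = sc a (lin_ext sc h p)" for a p
  proof -
    have "lin_ext sc h (smult a p) = (\<Sum>m\<in>keys p. sc (lookup (smult a p) m) (h m))"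
      by (rule lin_ext_superset[OF assms]) (auto simp: in_keys_iff)
    then show ?thesis
      by (simp add: lin_ext_def scale_sum_right)
  qed
  show ?thesis
    by unfold_locales (fact * **)+
qed

lemma vector_space_mult: "vector_space ((*) :: 'k::field \<Rightarrow> _)"
  by unfold_locales (auto simp: algebra_simps)

lemma vector_space_smult: "vector_space (smult :: 'k::field \<Rightarrow> ('m \<Rightarrow>\<^sub>0 'k) \<Rightarrow> _)"
  by unfold_locales

lemma lin_ext_single [simp]:
  "vector_space sc \<Longrightarrow> lin_ext sc h (Poly_Mapping.single m a) = sc a (h m)"
  by (subst lin_ext_superset[where A="{m}"]) auto

lemma smult_single [simp]: "smult a (Poly_Mapping.single m b) = Poly_Mapping.single m (a * b)"
  by (auto intro!: poly_mapping_eqI simp: lookup_single when_def)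

lemma pm_expand: "p = (\<Sum>m\<in>keys p. smult (lookup p m) (Poly_Mapping.single m (1::'k::field)))"
  by (rule poly_mapping_eqI)
     (auto simp: lookup_sum lookup_single when_def in_keys_iff sum.delta)

lemma linear_eqI:
  assumes "Vector_Spaces.linear smult sc f" "Vector_Spaces.linear smult sc g"
  assumes "\<And>m. f (Poly_Mapping.single m (1::'k::field)) = g (Poly_Mapping.single m 1)"
  shows "f p = g p"
proof -
  interpret f: Vector_Spaces.linear smult sc f by fact
  interpret g: Vector_Spaces.linear smult sc g by fact
  show ?thesis
    by (subst (1 2) pm_expand) (simp add: f.sum g.sum f.scale g.scale assms(3) del: smult_single)
qed

lemma lookup_tensor: "lookup (tensor p q) (m, n) = lookup p m * lookup q n"
proof -
  have "lookup (lin_ext smult (\<lambda>n. Poly_Mapping.single (m', n) 1) q) (m, n) = (if m' = m then lookup q n else 0)" for m'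
    by (auto simp: lin_ext_def lookup_sum lookup_single when_def in_keys_iff)
  then have "lookup (tensor p q) (m, n) = (\<Sum>m'\<in>keys p. if m' = m then lookup p m * lookup q n else 0)"
    unfolding tensor_def lin_ext_def[of _ _ p] lookup_sum lookup_smult
    by (intro sum.cong refl) simp
  then show ?thesis
    by (simp add: in_keys_iff)
qed

lemma algebra_hom_lin_ext:
  assumes "vector_space sc" and sc: "\<And>a b x y. sc a x * sc b y = sc (a * b) (x * y)"
  assumes h: "h 0 = 1" "\<And>m n. h (m + n) = h m * h n"
  shows "algebra_hom (sc :: 'k::field \<Rightarrow> _) (lin_ext sc h)"
proof -
  interpret vector_space sc by fact
  interpret L: Vector_Spaces.linear smult sc "lin_ext sc h"
    by (rule linear_lin_ext) fact
  let ?s = "\<lambda>m. Poly_Mapping.single m (1::'k)"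
  have "lin_ext sc h 1 = 1"
    using lin_ext_single[OF assms(1), of h 0 1] by (simp add: h)
  moreover have "lin_ext sc h (p * q) = lin_ext sc h p * lin_ext sc h q" for p q
  proof -
    have "p * q = (\<Sum>m\<in>keys p. smult (lookup p m) (?s m)) * (\<Sum>m\<in>keys q. smult (lookup q m) (?s m))"
      using pm_expand[of p] pm_expand[of q] by simp
    also have "\<dots> = (\<Sum>m\<in>keys p. \<Sum>n\<in>keys q. Poly_Mapping.single (m + n) (lookup p m * lookup q n))"
      by (simp add: sum_product mult_single)
    also have "lin_ext sc h \<dots> = (\<Sum>m\<in>keys p. \<Sum>n\<in>keys q. sc (lookup p m * lookup q n) (h m * h n))"
      by (simp add: L.sum assms(1) h)
    also have "\<dots> = lin_ext sc h p * lin_ext sc h q"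
      by (simp add: lin_ext_def sum_product sc)
    finally show ?thesis .
  qed
  ultimately show ?thesis
    unfolding algebra_hom_def using L.linear_axioms by blast
qed

lemma mon_eval_superset:
  assumes "finite A" "keys m \<subseteq> A"
  shows "mon_eval f m = (\<Prod>c\<in>A. f c ^ lookup m c)"
  unfolding mon_eval_def
  by (rule prod.mono_neutral_left) (use assms in \<open>auto simp: in_keys_iff\<close>)

lemma mon_eval_zero [simp]: "mon_eval f 0 = 1"
  by (simp add: mon_eval_def)

lemma mon_eval_single [simp]: "mon_eval f (Poly_Mapping.single c (Suc 0)) = f c"
  by (simp add: mon_eval_def)

lemma mon_eval_add: "mon_eval f (m + n) = mon_eval f m * mon_eval f n"
proof -
  have "mon_eval f r = (\<Prod>c\<in>keys m \<union> keys n. f c ^ lookup r c)" if "r \<in> {m, n, m + n}" for r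
    by (rule mon_eval_superset) (use that keys_add[of m n] in auto)
  then show ?thesis
    by (simp add: lookup_add power_add prod.distrib)
qed

lemma mon_eval_mult: "mon_eval (\<lambda>c. f c * g c) m = mon_eval f m * mon_eval g m"
  by (simp add: mon_eval_def power_mult_distrib prod.distrib)

lemma single_power:
  "Poly_Mapping.single m (1::'k::field) ^ n = Poly_Mapping.single (\<Sum>i<n. m) 1"
  by (induction n) (simp_all add: mult_single add.commute)

lemma single_prod:
  "finite A \<Longrightarrow> (\<Prod>c\<in>A. Poly_Mapping.single (F c) (1::'k::field)) = Poly_Mapping.single (\<Sum>c\<in>A. F c) 1"
  by (induction A rule: finite_induct) (simp_all add: mult_single)

lemma single_eq_mon_eval: "Poly_Mapping.single m (1::'k::field) = mon_eval coord m"
proof -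
  have "mon_eval coord m =
      Poly_Mapping.single (\<Sum>c\<in>keys m. \<Sum>i<lookup m c. Poly_Mapping.single c 1) (1::'k)"
    by (simp add: mon_eval_def coord_def single_power single_prod)
  also have "(\<Sum>c\<in>keys m. \<Sum>i<lookup m c. Poly_Mapping.single c (1::nat)) = m"
    by (rule poly_mapping_eqI)
       (auto simp: lookup_sum lookup_single when_def in_keys_iff sum.delta if_distrib cong: if_cong)
  finally show ?thesis by simp
qed

lemma algebra_hom_mon_eval:
  assumes "algebra_hom sc f"
  shows "f (mon_eval F m) = mon_eval (\<lambda>c. f (F c)) m"
proof -
  have m: "f 1 = 1" "f (p * q) = f p * f q" for p q
    using assms by (auto simp: algebra_hom_def)
  have pow: "f (p ^ n) = f p ^ n" for p n
    by (induction n) (simp_all add: m)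
  have "f (\<Prod>c\<in>A. F c ^ lookup m c) = (\<Prod>c\<in>A. f (F c) ^ lookup m c)" if "finite A" for A
    using that by (induction A rule: finite_induct) (simp_all add: m pow)
  then show ?thesis
    by (simp add: mon_eval_def)
qed

lemma algebra_hom_eqI:
  assumes "algebra_hom sc f" "algebra_hom sc g" "\<And>c. f (coord c) = g (coord c)"
  shows "f = g"
proof
  fix p
  show "f p = g p"
  proof (rule linear_eqI)
    show "Vector_Spaces.linear smult sc f" "Vector_Spaces.linear smult sc g"
      using assms by (auto simp: algebra_hom_def)
    show "f (Poly_Mapping.single m 1) = g (Poly_Mapping.single m 1)" for m
      using assms by (simp add: single_eq_mon_eval algebra_hom_mon_eval)
  qed
qed

lemma smult_mult_smult:
  "smult a p * smult b q = smult (a * b) (p * q :: 'm::comm_monoid_add \<Rightarrow>\<^sub>0 'k::field)"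
proof -
  have "smult a p * smult b q = (Poly_Mapping.single 0 a * Poly_Mapping.single 0 b) * (p * q)"
    unfolding smult_def mult_map_scale_conv_mult by (simp only: mult_ac)
  then show ?thesis
    by (simp add: smult_def mult_map_scale_conv_mult mult_single)
qed

lemma algebra_hom_lift:
  "algebra_hom smult (lin_ext smult (mon_eval (F :: word \<Rightarrow> ('m::comm_monoid_add \<Rightarrow>\<^sub>0 'k::field))))"
  by (rule algebra_hom_lin_ext) (auto simp: vector_space_smult mon_eval_add smult_mult_smult)

lemma lift_coord: "lin_ext smult (mon_eval F) (coord c) = F c"
  by (simp add: coord_def vector_space_smult)

lemma poly_fun_coord [simp]: "poly_fun (coord c) f = f c"
  by (simp add: poly_fun_def coord_def vector_space_mult)

lemma algebra_hom_poly_fun2: "algebra_hom (*) (\<lambda>P. poly_fun2 P f g)"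
  unfolding poly_fun2_def
  by (rule algebra_hom_lin_ext)
     (auto simp: vector_space_mult mon_eval_add zero_prod_def split: prod.splits)

lemma linear_poly_fun2: "Vector_Spaces.linear smult (*) (\<lambda>P. poly_fun2 P f g)"
  using algebra_hom_poly_fun2[of f g] by (simp add: algebra_hom_def)

lemma poly_fun2_mult: "poly_fun2 (P * Q) f g = poly_fun2 P f g * poly_fun2 Q f g"
  using algebra_hom_poly_fun2[of f g] by (simp add: algebra_hom_def)

text \<open>Distinct characters of a commutative monoid are linearly independent.\<close>

lemma dedekind:
  fixes \<chi> :: "'i \<Rightarrow> 'x \<Rightarrow> 'k::field" and op :: "'x \<Rightarrow> 'x \<Rightarrow> 'x"
  assumes "finite A"
  assumes mult: "\<And>i x y. i \<in> A \<Longrightarrow> \<chi> i (op x y) = \<chi> i x * \<chi> i y"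
  assumes one: "\<And>i. i \<in> A \<Longrightarrow> \<chi> i e = 1"
  assumes dist: "\<And>i j. i \<in> A \<Longrightarrow> j \<in> A \<Longrightarrow> i \<noteq> j \<Longrightarrow> \<exists>x. \<chi> i x \<noteq> \<chi> j x"
  assumes zero: "\<And>x. (\<Sum>i\<in>A. a i * \<chi> i x) = 0"
  shows "\<forall>i\<in>A. a i = 0"
  using assms
proof (induction A arbitrary: a rule: finite_induct)
  case empty
  then show ?case by simp
next
  case (insert j A)
  have A: "a i = 0" if i: "i \<in> A" for i
  proof -
    obtain y where y: "\<chi> i y \<noteq> \<chi> j y"
      using insert.prems(3)[of i j] insert.hyps i by auto
    have "\<forall>i\<in>A. a i * (\<chi> i y - \<chi> j y) = 0"
    proof (rule insert.IH)
      fix x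
      have "(\<Sum>i\<in>insert j A. a i * \<chi> i (op y x)) - \<chi> j y * (\<Sum>i\<in>insert j A. a i * \<chi> i x) = 0"
        using insert.prems(4) by simp
      moreover have "(\<Sum>i\<in>insert j A. a i * \<chi> i (op y x)) - \<chi> j y * (\<Sum>i\<in>insert j A. a i * \<chi> i x)
          = (\<Sum>i\<in>insert j A. a i * (\<chi> i y - \<chi> j y) * \<chi> i x)"
        unfolding sum_distrib_left sum_subtractf[symmetric]
        by (rule sum.cong) (simp_all add: insert.prems(1) algebra_simps)
      ultimately show "(\<Sum>i\<in>A. a i * (\<chi> i y - \<chi> j y) * \<chi> i x) = 0"
        using insert.hyps by simp
    qed (use insert.prems in auto)
    with i y show ?thesis by auto
  qed
  moreover have "a j = 0"
    using insert.prems(4)[of e] insert.prems(2) insert.hyps A by simp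
  ultimately show ?case by simp
qed

lemma poly_fun2_inject:
  fixes P Q :: "'k::field_char_0 HH"
  assumes "\<And>f g. poly_fun2 P f g = poly_fun2 Q f g"
  shows "P = Q"
proof -
  define mul :: "'k series \<times> 'k series \<Rightarrow> 'k series \<times> 'k series \<Rightarrow> 'k series \<times> 'k series"
    where "mul = (\<lambda>(f, g) (f', g'). (\<lambda>c. f c * f' c, \<lambda>c. g c * g' c))"
  define \<chi> :: "mon \<times> mon \<Rightarrow> 'k series \<times> 'k series \<Rightarrow> 'k"
    where "\<chi> = (\<lambda>(m, n) (f, g). mon_eval f m * mon_eval g n)"
  have two: "mon_eval (\<lambda>w. if w = c then 2 else 1) m = (2::'k) ^ lookup m c" for m c
    by (cases "c \<in> keys m")
       (auto simp: mon_eval_def if_distrib[of "\<lambda>x. x ^ _"] prod.delta in_keys_iff cong: if_cong)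
  have two_inj: "(2::'k) ^ a = 2 ^ b \<longleftrightarrow> a = b" for a b :: nat
  proof -
    have "(2::'k) ^ a = of_nat (2 ^ a)" "(2::'k) ^ b = of_nat (2 ^ b)"
      by simp_all
    then show ?thesis
      by (simp only: of_nat_eq_iff) simp
  qed
  have mon_eval_one: "mon_eval (\<lambda>_. 1) m = (1::'k)" for m
    by (simp add: mon_eval_def)
  have "\<forall>i\<in>keys (P - Q). lookup (P - Q) i = 0"
  proof (rule dedekind[where \<chi> = \<chi> and e = "(\<lambda>_. 1, \<lambda>_. 1)"
        and op = mul])
    show "\<chi> i (mul x y) = \<chi> i x * \<chi> i y" for i x y
      by (auto simp: \<chi>_def mul_def mon_eval_mult split: prod.splits)
  next
    show "\<chi> i (\<lambda>_. 1, \<lambda>_. 1) = 1" for i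
      by (auto simp: \<chi>_def mon_eval_def split: prod.splits)
  next
    fix i j :: "mon \<times> mon"
    assume "i \<noteq> j"
    obtain m n m' n' where ij: "i = (m, n)" "j = (m', n')"
      by fastforce
    show "\<exists>x. \<chi> i x \<noteq> \<chi> j x"
    proof (cases "m = m'")
      case False
      then obtain c where "lookup m c \<noteq> lookup m' c"
        by (auto intro: poly_mapping_eqI)
      then have "\<chi> i (\<lambda>w. if w = c then 2 else 1, \<lambda>_. 1) \<noteq> \<chi> j (\<lambda>w. if w = c then 2 else 1, \<lambda>_. 1)"
        unfolding \<chi>_def ij prod.case two
        by (simp add: two_inj mon_eval_one)
      then show ?thesis by blast
    next
      case True
      then obtain c where "lookup n c \<noteq> lookup n' c"
        using \<open>i \<noteq> j\<close> ij by (auto intro: poly_mapping_eqI)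
      then have "\<chi> i (\<lambda>_. 1, \<lambda>w. if w = c then 2 else 1) \<noteq> \<chi> j (\<lambda>_. 1, \<lambda>w. if w = c then 2 else 1)"
        unfolding \<chi>_def ij prod.case two
        by (simp add: two_inj mon_eval_one)
      then show ?thesis by blast
    qed
  next
    fix x :: "'k series \<times> 'k series"
    obtain f g where x: "x = (f, g)" by fastforce
    interpret L: Vector_Spaces.linear smult "(*)" "\<lambda>P. poly_fun2 P f g"
      by (rule linear_poly_fun2)
    have "poly_fun2 (P - Q) f g = 0"
      using assms by (simp add: L.diff)
    then show "(\<Sum>i\<in>keys (P - Q). lookup (P - Q) i * \<chi> i x) = 0"
      by (simp add: poly_fun2_def lin_ext_def \<chi>_def x split_def)
  qed simp
  then have "P - Q = 0"
    by (intro poly_mapping_eqI) (auto simp: in_keys_iff)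
  then show ?thesis by simp
qed

definition is_poly2 :: "('k::field series \<Rightarrow> 'k series \<Rightarrow> 'k) \<Rightarrow> bool" where
  "is_poly2 F \<longleftrightarrow> (\<exists>P. \<forall>f g. poly_fun2 P f g = F f g)"

lemma is_poly2_const: "is_poly2 (\<lambda>f g. a)"
  unfolding is_poly2_def
  by (rule exI[of _ "Poly_Mapping.single 0 a"])
     (simp add: poly_fun2_def vector_space_mult zero_prod_def)

lemma is_poly2_fst: "is_poly2 (\<lambda>f g. f c)"
  unfolding is_poly2_def
  by (rule exI[of _ "Poly_Mapping.single (Poly_Mapping.single c 1, 0) 1"])
     (simp add: poly_fun2_def vector_space_mult)

lemma is_poly2_snd: "is_poly2 (\<lambda>f g. g c)"
  unfolding is_poly2_def
  by (rule exI[of _ "Poly_Mapping.single (0, Poly_Mapping.single c 1) 1"])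
     (simp add: poly_fun2_def vector_space_mult)

lemma is_poly2_add: "is_poly2 F \<Longrightarrow> is_poly2 G \<Longrightarrow> is_poly2 (\<lambda>f g. F f g + G f g)"
proof -
  assume "is_poly2 F" "is_poly2 G"
  then obtain P Q where PQ: "\<And>f g. poly_fun2 P f g = F f g" "\<And>f g. poly_fun2 Q f g = G f g"
    unfolding is_poly2_def by blast
  have "poly_fun2 (P + Q) f g = F f g + G f g" for f g
  proof -
    interpret L: Vector_Spaces.linear smult "(*)" "\<lambda>P. poly_fun2 P f g"
      by (rule linear_poly_fun2)
    show ?thesis by (simp add: L.add PQ)
  qed
  then show ?thesis unfolding is_poly2_def by blast
qed

lemma is_poly2_mult: "is_poly2 F \<Longrightarrow> is_poly2 G \<Longrightarrow> is_poly2 (\<lambda>f g. F f g * G f g)"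
  unfolding is_poly2_def using poly_fun2_mult by metis

lemma is_poly2_sum:
  "finite A \<Longrightarrow> (\<And>i. i \<in> A \<Longrightarrow> is_poly2 (F i)) \<Longrightarrow> is_poly2 (\<lambda>f g. \<Sum>i\<in>A. F i f g)"
  by (induction A rule: finite_induct) (simp_all add: is_poly2_const is_poly2_add)

lemmas is_poly2_intros = is_poly2_const is_poly2_fst is_poly2_snd is_poly2_add is_poly2_mult is_poly2_sum

lemma finite_words: "finite {w :: word. length w \<le> n}"
proof -
  have "(UNIV :: letter set) = {x0, x1}"
    using letter.exhaust by auto
  then have "finite (UNIV :: letter set)"
    by (metis finite.emptyI finite.insertI)
  from finite_lists_length_le[OF this, of n] show ?thesis by simp
qed

lemma count_shuffle_words_eq_0:
  "length w \<noteq> length u + length v \<Longrightarrow> count (shuffle_words u v) w = 0"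
proof -
  have "w \<in># shuffle_words u v \<Longrightarrow> length w = length u + length v" for w
    by (induction u v arbitrary: w rule: shuffle_words.induct) auto
  then show "length w \<noteq> length u + length v \<Longrightarrow> count (shuffle_words u v) w = 0"
    by (metis count_inI)
qed

lemma shuffle_eq_sum:
  "shuffle f g w = (\<Sum>(u, v)\<in>{u. length u \<le> length w} \<times> {v. length v \<le> length w}.
     f u * g v * of_nat (count (shuffle_words u v) w))"
  unfolding shuffle_def
proof (rule Sum_any.expand_superset)
  show "{x. (case x of (u, v) \<Rightarrow> f u * g v * of_nat (count (shuffle_words u v) w)) \<noteq> 0}
      \<subseteq> {u. length u \<le> length w} \<times> {v. length v \<le> length w}"
  proof safe
    fix u v
    assume "f u * g v * of_nat (count (shuffle_words u v) w) \<noteq> 0"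
    then have "length w = length u + length v"
      using count_shuffle_words_eq_0[of w u v] by fastforce
    then show "length u \<le> length w" "length v \<le> length w" by simp_all
  qed
qed (simp add: finite_words)

lemma shuffle_eq_0:
  assumes "\<And>v. length v < n \<Longrightarrow> g v = 0" "length w < n"
  shows "shuffle f g w = 0"
  unfolding shuffle_eq_sum by (rule sum.neutral) (use assms in auto)

lemma phi_word_eq_0: "length u < length w \<Longrightarrow> phi_word d w X u = 0"
proof (induction w arbitrary: u)
  case (Cons a w)
  then show ?case
    by (cases u) (auto simp: phi_letter_def lmult_def split: letter.splits
        intro!: shuffle_eq_0[of "length w"])
qed simp

lemma phi_eq_sum: "phi d c X u = (\<Sum>w\<in>{w. length w \<le> length u}. c w * phi_word d w X u)"
  unfolding phi_def
proof (rule Sum_any.expand_superset)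
  show "{w. c w * phi_word d w X u \<noteq> 0} \<subseteq> {w. length w \<le> length u}"
    using phi_word_eq_0[of u _ d X] by (force simp: not_le[symmetric])
qed (rule finite_words)

lemma is_poly2_phi_word: "is_poly2 (\<lambda>f g. phi_word g w one_series u)"
proof (induction w arbitrary: u)
  case Nil
  then show ?case by (simp add: is_poly2_const)
next
  case (Cons a w)
  have if_poly: "is_poly2 (\<lambda>f g. if b then F f g else 0)" if "is_poly2 F" for b and F :: "'a series \<Rightarrow> 'a series \<Rightarrow> 'a"
    using that by (cases b) (auto intro: is_poly2_const)
  show ?case
    by (cases a; cases u rule: list.exhaust)
       (auto simp: phi_letter_def lmult_def shuffle_eq_sum split_def finite_words 
         intro!: if_poly is_poly2_intros Cons.IH)
qed

lemma is_poly2_compose: "is_poly2 (\<lambda>f g. compose f g u)"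
  unfolding compose_def phi_eq_sum
  by (intro is_poly2_intros is_poly2_phi_word finite_words)

lemma ex1_coproduct: "\<exists>!\<Delta> :: 'k::field_char_0 H \<Rightarrow> 'k HH. is_coproduct \<Delta>"
proof -
  obtain D :: "word \<Rightarrow> 'k HH" where D: "\<And>c f g. poly_fun2 (D c) f g = compose f g c"
    using is_poly2_compose unfolding is_poly2_def by metis
  have "is_coproduct (lin_ext smult (mon_eval D))"
    by (simp add: is_coproduct_def algebra_hom_lift lift_coord D)
  moreover have "\<Delta> = \<Delta>'" if "is_coproduct \<Delta>" "is_coproduct \<Delta>'" for \<Delta> \<Delta>' :: "'k H \<Rightarrow> 'k HH"
    by (rule algebra_hom_eqI) (use that in \<open>auto simp: is_coproduct_def intro!: poly_fun2_inject\<close>)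
  ultimately show ?thesis by blast
qed

lemma is_coproduct_coproduct: "is_coproduct (coproduct :: 'k::field_char_0 H \<Rightarrow> 'k HH)"
  unfolding coproduct_def using theI'[OF ex1_coproduct] .

end

theory Submission
  imports Defs
begin

text \<open>
  Polynomials are determined by their values on series, so the Hopf algebra axioms amount to the
  statement that series form a group under composition, with polynomial inversion. The identities
  between series are proved coefficientwise by induction on words: left quotients by letters are
  derivations for the shuffle product, and \<open>T = phi d _ one_series\<close> satisfies
  \<open>x1\<inverse> (T f) = T (x1\<inverse> f)\<close> and \<open>x0\<inverse> (T f) = T (x0\<inverse> f) + d \<star> T (x1\<inverse> f)\<close>, writing \<open>\<star>\<close> for the
  shuffle product. It follows that \<open>T\<close> is a shuffle morphism (whence associativity) and that it can be
  inverted by recursion on words. The coproduct is homogeneous because multiplying the coefficient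
  of each word \<open>c\<close> by \<open>2 ^ deg c\<close> is an automorphism of the group, and the powers of 2 are distinct
  in characteristic zero.
\<close>

section \<open>The group of series\<close>

abbreviation deriv :: "letter \<Rightarrow> 'k series \<Rightarrow> 'k series" where
  "deriv a f \<equiv> \<lambda>u. f (a # u)"

abbreviation words_upto :: "nat \<Rightarrow> word set" where
  "words_upto n \<equiv> {w. length w \<le> n}"

abbreviation act :: "'k::comm_semiring_1 series \<Rightarrow> 'k series \<Rightarrow> 'k series" where
  "act d c \<equiv> phi d c one_series"

text \<open>Splitting truncated sums by the first letter turns the sums behind
  \<open>shuffle\<close> and \<open>phi\<close> into recursions on words.\<close>

lemma sum_words_upto_Suc:
  fixes F :: "word \<Rightarrow> 'a::comm_monoid_add"
  shows "(\<Sum>w\<in>words_upto (Suc n). F w) =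
    F [] + (\<Sum>w\<in>words_upto n. F (x0 # w)) + (\<Sum>w\<in>words_upto n. F (x1 # w))"
proof -
  let ?W = "words_upto n"
  have inj: "inj_on ((#) a) A" for a :: letter and A
    by (simp add: inj_on_def)
  have "words_upto (Suc n) = insert [] ((#) x0 ` ?W \<union> (#) x1 ` ?W)"
  proof (rule set_eqI)
    fix w
    show "w \<in> words_upto (Suc n) \<longleftrightarrow> w \<in> insert [] ((#) x0 ` ?W \<union> (#) x1 ` ?W)"
      by (cases w; cases "hd w") auto
  qed
  then have "(\<Sum>w\<in>words_upto (Suc n). F w) = F [] + (\<Sum>w\<in>(#) x0 ` ?W \<union> (#) x1 ` ?W. F w)"
    by (simp add: finite_words image_iff)
  also have "(\<Sum>w\<in>(#) x0 ` ?W \<union> (#) x1 ` ?W. F w) = (\<Sum>w\<in>(#) x0 ` ?W. F w) + (\<Sum>w\<in>(#) x1 ` ?W. F w)"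
    by (rule sum.union_disjoint) (auto simp: finite_words)
  finally show ?thesis
    by (simp add: sum.reindex[OF inj] add.assoc)
qed

text \<open>Lengths add under shuffling, so enlarging the truncation only adds zero terms. The two
  bounds are independent because the recursion removes a letter from one factor at a time.\<close>

lemma shuffle_eq_sum_upto:
  assumes "length w \<le> m" "length w \<le> n"
  shows "shuffle f g w = (\<Sum>u\<in>words_upto m. \<Sum>v\<in>words_upto n.
    f u * g v * of_nat (count (shuffle_words u v) w))"
proof -
  have "shuffle f g w = (\<Sum>(u, v)\<in>words_upto m \<times> words_upto n.
      f u * g v * of_nat (count (shuffle_words u v) w))"
    unfolding shuffle_eq_sum
  proof (rule sum.mono_neutral_left)
    show "\<forall>x\<in>words_upto m \<times> words_upto n - words_upto (length w) \<times> words_upto (length w).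
      (case x of (u, v) \<Rightarrow> f u * g v * of_nat (count (shuffle_words u v) w)) = 0"
    proof
      fix x
      assume x: "x \<in> words_upto m \<times> words_upto n - words_upto (length w) \<times> words_upto (length w)"
      obtain u v where uv: "x = (u, v)" by fastforce
      with x have "length w \<noteq> length u + length v" by auto
      then show "(case x of (u, v) \<Rightarrow> f u * g v * of_nat (count (shuffle_words u v) w)) = 0"
        by (simp add: uv count_shuffle_words_eq_0)
    qed
  qed (use assms in \<open>auto simp: finite_words\<close>)
  then show ?thesis
    by (simp add: sum.cartesian_product)
qed

lemma shuffle_Nil [simp]: "shuffle f g [] = f [] * g []"
  by (simp add: shuffle_eq_sum_upto[of _ 0 0])

lemma count_image_Cons: "count (image_mset ((#) b) M) (a # w) = (if b = a then count M w else 0)"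
  by (induction M) auto

lemma count_shuffle_words_Cons:
  "count (shuffle_words u v) (a # w) =
     (case u of [] \<Rightarrow> 0 | b # u' \<Rightarrow> if b = a then count (shuffle_words u' v) w else 0) +
     (case v of [] \<Rightarrow> 0 | b # v' \<Rightarrow> if b = a then count (shuffle_words u v') w else 0)"
proof -
  have Nil2: "shuffle_words u [] = {#u#}" for u
    by (cases u) auto
  show ?thesis
    by (cases u; cases v) (auto simp: count_image_Cons Nil2)
qed

lemma sum_words_upto_case:
  fixes F :: "word \<Rightarrow> 'a::semiring_0"
  shows "(\<Sum>w\<in>words_upto (Suc n). F w * (case w of [] \<Rightarrow> 0 | b # w' \<Rightarrow> if b = a then G w' else 0)) =
    (\<Sum>w\<in>words_upto n. F (a # w) * G w)"
  unfolding sum_words_upto_Suc by (cases a) auto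

text \<open>Leibniz rule: the first letter of a shuffle of \<open>u\<close> and \<open>v\<close>
  comes from \<open>u\<close> or from \<open>v\<close>. With \<open>shuffle_Nil\<close>, it allows
  identities between shuffles to be proved by induction on the word.\<close>

lemma shuffle_Cons [simp]:
  "shuffle f g (a # w) = shuffle (deriv a f) g w + shuffle f (deriv a g) w"
proof -
  define n where "n = length w"
  let ?c = "\<lambda>u v. of_nat (count (shuffle_words u v) w)"
  \<comment> \<open>\<open>?C u v\<close> counts the ways to obtain \<open>a # w\<close> with its
    first letter taken from \<open>u\<close>, and \<open>?D u v\<close> those with it taken from
    \<open>v\<close>.\<close>
  let ?C = "\<lambda>u v. case u of [] \<Rightarrow> 0 | b # u' \<Rightarrow> if b = a then ?c u' v else 0"
  let ?D = "\<lambda>u v. case v of [] \<Rightarrow> 0 | b # v' \<Rightarrow> if b = a then ?c u v' else 0"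
  have count: "of_nat (count (shuffle_words u v) (a # w)) = (?C u v + ?D u v :: 'a)" for u v
    unfolding count_shuffle_words_Cons of_nat_add by (auto split: list.splits)
  have "shuffle f g (a # w) = (\<Sum>u\<in>words_upto (Suc n). \<Sum>v\<in>words_upto (Suc n). f u * g v * (?C u v + ?D u v))"
    by (subst shuffle_eq_sum_upto[of _ "Suc n" "Suc n"]) (simp_all add: n_def count)
  also have "\<dots> = (\<Sum>v\<in>words_upto (Suc n). \<Sum>u\<in>words_upto (Suc n). (f u * g v) * ?C u v)
      + (\<Sum>u\<in>words_upto (Suc n). \<Sum>v\<in>words_upto (Suc n). (f u * g v) * ?D u v)"
    by (subst sum.swap) (simp add: distrib_left sum.distrib)
  also have "\<dots> = (\<Sum>v\<in>words_upto (Suc n). \<Sum>u\<in>words_upto n. f (a # u) * g v * ?c u v)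
      + (\<Sum>u\<in>words_upto (Suc n). \<Sum>v\<in>words_upto n. f u * g (a # v) * ?c u v)"
    by (simp only: sum_words_upto_case)
  also have "(\<Sum>v\<in>words_upto (Suc n). \<Sum>u\<in>words_upto n. f (a # u) * g v * ?c u v) = shuffle (deriv a f) g w"
    by (subst sum.swap, subst shuffle_eq_sum_upto[of _ n "Suc n"]) (simp_all add: n_def)
  also have "(\<Sum>u\<in>words_upto (Suc n). \<Sum>v\<in>words_upto n. f u * g (a # v) * ?c u v) = shuffle f (deriv a g) w"
    by (subst shuffle_eq_sum_upto[of _ "Suc n" n]) (simp_all add: n_def)
  finally show ?thesis .
qed

text \<open>Factors are never longer than their shuffle. This lets an induction hypothesis on words
  of bounded length be applied inside a shuffle.\<close>

lemma shuffle_cong: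
  assumes "\<And>v. length v \<le> length w \<Longrightarrow> f v = f' v" "\<And>v. length v \<le> length w \<Longrightarrow> g v = g' v"
  shows "shuffle f g w = shuffle f' g' w"
  unfolding shuffle_eq_sum by (intro sum.cong refl) (use assms in auto)

section \<open>Commutativity, bilinearity and associativity of the shuffle product\<close>

lemma shuffle_commute: "shuffle f g w = shuffle g f w"
  by (induction w arbitrary: f g) (simp_all add: mult.commute add.commute)

lemma shuffle_add_left: "shuffle (\<lambda>u. f u + g u) h w = shuffle f h w + shuffle g h w"
  by (induction w arbitrary: f g h) (simp_all add: algebra_simps)

lemma shuffle_add_right: "shuffle h (\<lambda>u. f u + g u) w = shuffle h f w + shuffle h g w"
  by (simp add: shuffle_commute[of h] shuffle_add_left)

lemma shuffle_scale_left: "shuffle (\<lambda>u. a * f u) g w = a * shuffle f g w"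
  by (induction w arbitrary: f g) (simp_all add: algebra_simps)

lemma shuffle_scale_right: "shuffle f (\<lambda>u. a * g u) w = a * shuffle f g w"
  by (simp add: shuffle_commute[of f] shuffle_scale_left)

lemma shuffle_zero_left [simp]: "shuffle (\<lambda>_. 0) g w = 0"
  by (induction w arbitrary: g) simp_all

lemma shuffle_sum_right: "shuffle h (\<lambda>u. \<Sum>i\<in>A. f i u) w = (\<Sum>i\<in>A. shuffle h (f i) w)"
proof (induction A rule: infinite_finite_induct)
  case (insert i A)
  then show ?case by (simp add: shuffle_add_right)
qed (simp_all add: shuffle_commute[of h])

lemma shuffle_assoc: "shuffle (shuffle f g) h w = shuffle f (shuffle g h) w"
  by (induction w arbitrary: f g h)
     (simp_all add: shuffle_add_left shuffle_add_right algebra_simps)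

section \<open>The operator \<open>act d\<close> and its compatibility with shuffles\<close>

lemma act_eq_sum_upto:
  assumes "length u \<le> n"
  shows "act d c u = (\<Sum>w\<in>words_upto n. c w * phi_word d w one_series u)"
  unfolding phi_eq_sum
proof (rule sum.mono_neutral_left)
  show "\<forall>w\<in>words_upto n - words_upto (length u). c w * phi_word d w one_series u = 0"
    by (simp add: phi_word_eq_0 not_le)
qed (use assms in \<open>auto simp: finite_words\<close>)

lemma act_Nil [simp]: "act d c [] = c []"
  by (simp add: act_eq_sum_upto[of _ 0] one_series_def)

lemma act_Cons_x1 [simp]: "act d c (x1 # u) = act d (deriv x1 c) u"
  by (subst act_eq_sum_upto[of _ "Suc (length u)"])
     (simp_all add: act_eq_sum_upto[of u "length u"] sum_words_upto_Suc phi_letter_def lmult_def one_series_def)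

text \<open>The letter \<open>x1\<close> also acts by \<open>x0\<close> times the shuffle with
  \<open>d\<close>, so words of \<open>c\<close> beginning with either letter contribute
  here.\<close>

lemma act_Cons_x0 [simp]:
  "act d c (x0 # u) = act d (deriv x0 c) u + shuffle d (act d (deriv x1 c)) u"
proof -
  let ?n = "length u"
  \<comment> \<open>Only words no longer than \<open>u\<close> matter, so one finite sum replaces
    the series, and the shuffle with \<open>d\<close> can be moved inside it.\<close>
  have "shuffle d (act d (deriv x1 c)) u =
      shuffle d (\<lambda>v. \<Sum>w\<in>words_upto ?n. c (x1 # w) * phi_word d w one_series v) u"
    by (rule shuffle_cong) (simp_all add: act_eq_sum_upto)
  also have "\<dots> = (\<Sum>w\<in>words_upto ?n. c (x1 # w) * shuffle d (phi_word d w one_series) u)"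
    by (simp add: shuffle_sum_right shuffle_scale_right)
  finally show ?thesis
    by (subst act_eq_sum_upto[of _ "Suc ?n"])
       (simp_all add: act_eq_sum_upto[of u ?n] sum_words_upto_Suc phi_letter_def lmult_def one_series_def)
qed

lemma act_add: "act d (\<lambda>u. f u + g u) w = act d f w + act d g w"
  by (simp add: phi_eq_sum distrib_right sum.distrib)

lemma act_scale: "act d (\<lambda>u. a * f u) w = a * act d f w"
  by (simp add: phi_eq_sum sum_distrib_left mult.assoc)

lemma act_zero [simp]: "act d (\<lambda>_. 0) w = 0"
  by (simp add: phi_eq_sum)

lemma shuffle_left_commute: "shuffle f (shuffle g h) w = shuffle g (shuffle f h) w"
proof -
  have "shuffle (shuffle f g) h w = shuffle (shuffle g f) h w"
    by (rule shuffle_cong) (simp_all add: shuffle_commute)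
  then show ?thesis by (simp add: shuffle_assoc)
qed

text \<open>Both sides obey the same recursion: left quotients are derivations, and the correction
  by \<open>e\<close> respects the Leibniz rule because shuffling is associative and commutative.
  The induction is on length since the shuffle with \<open>e\<close> involves all words up to the
  length of \<open>u\<close>.\<close>

lemma act_shuffle: "act e (shuffle f g) w = shuffle (act e f) (act e g) w"
proof (induction "length w" arbitrary: w f g rule: less_induct)
  case less
  show ?case
  proof (cases w)
    case (Cons a u)
    have IH: "act e (shuffle f' g') u = shuffle (act e f') (act e g') u" for f' g'
      by (rule less) (simp add: Cons)
    \<comment> \<open>The induction hypothesis under the shuffle with \<open>e\<close>, for the two
      terms that the Leibniz rule for \<open>x1\<close> produces.\<close>
    have "shuffle e (act e (\<lambda>v. shuffle f' g' v + shuffle f'' g'' v)) u =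
        shuffle e (\<lambda>v. shuffle (act e f') (act e g') v + shuffle (act e f'') (act e g'') v) u"
      for f' g' f'' g''
      by (rule shuffle_cong) (simp_all add: act_add less Cons)
    then show ?thesis
      using shuffle_left_commute[of e "act e f" "act e (deriv x1 g)" u]
      by (cases a) (simp_all add: Cons IH act_add shuffle_add_left shuffle_add_right shuffle_assoc add_ac)
  qed simp
qed

section \<open>Associativity of the composition\<close>

lemma compose_eq: "compose c d = (\<lambda>u. act d c u + d u)"
  by (simp add: compose_def fun_eq_iff)

text \<open>At a word beginning with \<open>x0\<close>, \<open>act_shuffle\<close> turns the inner
  shuffle with \<open>d\<close> into one with \<open>act e d\<close>, and the outer operator adds a
  shuffle with \<open>e\<close>. The sum of these two series is \<open>compose d e\<close>.\<close>

lemma act_act: "act e (act d c) w = act (compose d e) c w"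
proof (induction "length w" arbitrary: w c rule: less_induct)
  case less
  show ?case
  proof (cases w)
    case (Cons a u)
    have IH: "act e (act d c') u = act (compose d e) c' u" for c'
      by (rule less) (simp add: Cons)
    have "shuffle F (act e (act d c')) u = shuffle F (act (compose d e) c') u" for F c'
      by (rule shuffle_cong) (simp_all add: less Cons)
    moreover have "shuffle (compose d e) G u = shuffle (act e d) G u + shuffle e G u" for G
      by (simp only: compose_eq shuffle_add_left)
    ultimately show ?thesis
      by (cases a) (simp_all add: Cons IH act_add act_shuffle add.assoc)
  qed simp
qed

lemma compose_assoc: "compose (compose c d) e = compose c (compose d e)"
proof
  fix u
  have "compose (compose c d) e u = act e (\<lambda>v. act d c v + d v) u + e u"
    by (simp only: compose_eq)
  also have "\<dots> = act (compose d e) c u + (act e d u + e u)"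
    by (simp only: act_add act_act add.assoc)
  also have "\<dots> = compose c (compose d e) u"
    by (simp only: compose_eq)
  finally show "compose (compose c d) e u = compose c (compose d e) u" .
qed

section \<open>Neutral element, inversion, and polynomiality of inversion\<close>

lemma compose_zero_left: "compose (\<lambda>_. 0) d = d"
  by (simp add: compose_eq)

lemma compose_zero_right: "compose c (\<lambda>_. 0) = c"
proof -
  have "act (\<lambda>_. 0) c w = c w" for w
  proof (induction w arbitrary: c)
    case (Cons a w)
    then show ?case by (cases a) simp_all
  qed simp
  then show ?thesis by (simp add: compose_eq)
qed

text \<open>Solves \<open>act d c' = c\<close> for \<open>c'\<close>. The operator must send the
  quotient of \<open>c'\<close> by \<open>x1\<close> to \<open>deriv x1 c\<close>, so the correction
  in the \<open>x0\<close> part is \<open>shuffle d (deriv x1 c)\<close>, subtracted before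
  inverting.\<close>

fun act_inv :: "'k::comm_ring_1 series \<Rightarrow> 'k series \<Rightarrow> 'k series" where
  "act_inv d c [] = c []"
| "act_inv d c (x1 # u) = act_inv d (deriv x1 c) u"
| "act_inv d c (x0 # u) = act_inv d (\<lambda>v. c (x0 # v) - shuffle d (deriv x1 c) v) u"

lemma act_act_inv: "act d (act_inv d c) w = c w"
proof (induction "length w" arbitrary: w c rule: less_induct)
  case less
  show ?case
  proof (cases w)
    case (Cons a u)
    have "shuffle d (act d (act_inv d c')) u = shuffle d c' u" for c'
      by (rule shuffle_cong) (simp_all add: less Cons)
    then show ?thesis
      by (cases a) (simp_all add: Cons less)
  qed simp
qed

text \<open>The equation \<open>compose g f = 0\<close> reads \<open>act f g = - f\<close>, which
  \<open>act_inv\<close> solves.\<close>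

definition compose_inv :: "'k::comm_ring_1 series \<Rightarrow> 'k series" where
  "compose_inv f u = - act_inv f f u"

lemma compose_inv_left: "compose (compose_inv f) f = (\<lambda>_. 0)"
proof -
  have "act f (compose_inv f) w = - f w" for w
    using act_scale[of f "- 1" "act_inv f f" w]
    by (simp add: compose_inv_def[abs_def] act_act_inv)
  then show ?thesis by (simp add: compose_eq)
qed

lemma compose_inv_right: "compose f (compose_inv f) = (\<lambda>_. 0)"
proof -
  let ?i = compose_inv
  \<comment> \<open>The inserted left factor is the neutral series by
    \<open>compose_inv_left\<close>; reassociating then brings \<open>?i f\<close> and
    \<open>f\<close> together.\<close>
  have "compose f (?i f) = compose (compose (?i (?i f)) (?i f)) (compose f (?i f))"
    by (simp add: compose_inv_left compose_zero_left)
  also have "\<dots> = compose (?i (?i f)) (compose (compose (?i f) f) (?i f))"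
    by (simp only: compose_assoc)
  finally show ?thesis
    by (simp add: compose_inv_left compose_zero_left)
qed

lemma is_poly2_diff: "is_poly2 F \<Longrightarrow> is_poly2 G \<Longrightarrow> is_poly2 (\<lambda>f g. F f g - G f g)"
  using is_poly2_add[OF _ is_poly2_mult[OF is_poly2_const[of "- 1"]], of F G] by simp

text \<open>The recursion changes the second argument of \<open>act_inv\<close>, so it is allowed to
  be any series \<open>F f\<close> with coefficients polynomial in \<open>f\<close>.\<close>

lemma is_poly2_act_inv:
  assumes "\<And>u. is_poly2 (\<lambda>f g :: 'k::field series. F f u)"
  shows "is_poly2 (\<lambda>f g. act_inv f (F f) w)"
  using assms
proof (induction w arbitrary: F)
  case (Cons a w)
  have "is_poly2 (\<lambda>f g :: 'k series. shuffle f (deriv x1 (F f)) u)" for u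
    unfolding shuffle_eq_sum split_def
    by (intro is_poly2_intros Cons.prems finite_cartesian_product finite_words)
  then have "is_poly2 (\<lambda>f g. act_inv f (\<lambda>v. F f (x0 # v) - shuffle f (deriv x1 (F f)) v) w)"
    by (intro Cons.IH is_poly2_diff Cons.prems)
  moreover have "is_poly2 (\<lambda>f g. act_inv f (deriv x1 (F f)) w)"
    by (intro Cons.IH Cons.prems)
  ultimately show ?case
    by (cases a) simp_all
qed simp

lemma is_poly2_compose_inv: "is_poly2 (\<lambda>f g. compose_inv f c)"
  using is_poly2_diff[OF is_poly2_const[of 0] is_poly2_act_inv[OF is_poly2_fst]]
  by (simp add: compose_inv_def)

section \<open>The Hopf algebra axioms\<close>

lemma linear_comp:
  "Vector_Spaces.linear s1 s2 f \<Longrightarrow> Vector_Spaces.linear s2 s3 g \<Longrightarrow> Vector_Spaces.linear s1 s3 (\<lambda>x. g (f x))"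
  using Vector_Spaces.linear_compose[of s1 s2 f s3 g] by (simp add: comp_def)

lemma linear_lin_ext_comp:
  assumes "Vector_Spaces.linear smult sc L" "vector_space sc"
  shows "L (lin_ext smult h P) = lin_ext sc (\<lambda>m. L (h m)) (P :: 'm \<Rightarrow>\<^sub>0 'k::field)"
proof -
  interpret L: Vector_Spaces.linear smult sc L by fact
  show ?thesis
    by (simp add: lin_ext_def L.sum L.scale)
qed

lemma algebra_hom_comp:
  assumes "algebra_hom smult f" "algebra_hom sc g"
  shows "algebra_hom sc (\<lambda>p. g (f p))"
  using assms linear_comp[of smult smult f sc g] by (auto simp: algebra_hom_def)

lemma algebra_hom_poly_fun: "algebra_hom (*) (\<lambda>p. poly_fun p f)"
  unfolding poly_fun_def
  by (rule algebra_hom_lin_ext) (auto simp: vector_space_mult mon_eval_add)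

lemma linear_poly_fun: "Vector_Spaces.linear smult (*) (\<lambda>p. poly_fun p f)"
  using algebra_hom_poly_fun[of f] by (simp add: algebra_hom_def)

lemma poly_fun_single [simp]: "poly_fun (Poly_Mapping.single m a) f = a * mon_eval f m"
  by (simp add: poly_fun_def vector_space_mult)

text \<open>Stated for arbitrary \<open>a\<close> and \<open>b\<close>, so that one of them may
  itself be a product of two evaluations, as happens for triple tensors.\<close>

lemma lin_ext_tensor:
  fixes p :: "'m \<Rightarrow>\<^sub>0 'k::field"
  shows "lin_ext (*) (\<lambda>(x, y). a x * b y) (tensor p q) = lin_ext (*) a p * lin_ext (*) b q"
proof -
  have "keys (tensor p q) \<subseteq> keys p \<times> keys q"
    by (auto simp: in_keys_iff lookup_tensor)
  then have "lin_ext (*) (\<lambda>(x, y). a x * b y) (tensor p q) =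
      (\<Sum>(x, y)\<in>keys p \<times> keys q. (lookup p x * a x) * (lookup q y * b y))"
    by (subst lin_ext_superset[OF vector_space_mult, of "keys p \<times> keys q"])
       (auto simp: lookup_tensor mult_ac intro!: sum.cong)
  then show ?thesis
    by (simp add: lin_ext_def sum_product sum.cartesian_product)
qed

lemma lin_ext_tensor_map:
  "lin_ext (*) (\<lambda>(x, y). a x * b y) (tensor_map F G P) =
    lin_ext (*) (\<lambda>(m, n). lin_ext (*) a (F (Poly_Mapping.single m 1)) *
      lin_ext (*) b (G (Poly_Mapping.single n 1))) (P :: 'm \<times> 'n \<Rightarrow>\<^sub>0 'k::field)"
  unfolding tensor_map_def
  by (subst linear_lin_ext_comp[OF linear_lin_ext[OF vector_space_mult] vector_space_mult])
     (simp add: split_def lin_ext_tensor[unfolded split_def])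

section \<open>Elements of \<open>H\<close> and of its triple tensor power are determined by their
  values\<close>

lemma poly_fun_inject:
  fixes p q :: "'k::field_char_0 H"
  assumes "\<And>f. poly_fun p f = poly_fun q f"
  shows "p = q"
proof -
  \<comment> \<open>Tensoring with 1 gives a function of two series that is constant in the second,
    which reduces the claim to \<open>poly_fun2_inject\<close>.\<close>
  have "poly_fun2 (tensor r 1) f g = poly_fun r f" for r :: "'k H" and f g
    unfolding poly_fun2_def lin_ext_tensor poly_fun_def[symmetric]
    using poly_fun_single[of 0 1 g] by simp
  then have "tensor p (1 :: 'k H) = tensor q 1"
    using assms by (intro poly_fun2_inject) simp
  then have "lookup p m * lookup (1 :: 'k H) 0 = lookup q m * lookup (1 :: 'k H) 0" for m
    by (simp only: lookup_tensor[symmetric])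
  then show ?thesis
    by (intro poly_mapping_eqI) simp
qed

text \<open>Coassociativity is tested on triples of series, hence needs that elements of the triple
  tensor product are determined by their values.\<close>

definition poly_fun3 ::
  "(mon \<times> mon \<times> mon \<Rightarrow>\<^sub>0 'k::field) \<Rightarrow> 'k series \<Rightarrow> 'k series \<Rightarrow> 'k series \<Rightarrow> 'k" where
  "poly_fun3 P f g h =
     lin_ext (*) (\<lambda>(m, y). mon_eval f m * (case y of (n, r) \<Rightarrow> mon_eval g n * mon_eval h r)) P"

text \<open>The variables are separated: \<open>C f\<close> evaluates the first factor at
  \<open>f\<close>, leaving an element of the tensor square determined by its values. Its
  coefficient at \<open>y\<close> is the value at \<open>f\<close> of the polynomial
  \<open>slice y\<close>, which is determined in turn.\<close>

lemma poly_fun3_inject: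
  fixes P Q :: "mon \<times> mon \<times> mon \<Rightarrow>\<^sub>0 'k::field_char_0"
  assumes "\<And>f g h. poly_fun3 P f g h = poly_fun3 Q f g h"
  shows "P = Q"
proof -
  define C :: "'k series \<Rightarrow> (mon \<times> mon \<times> mon \<Rightarrow>\<^sub>0 'k) \<Rightarrow> 'k HH"
    where "C f = lin_ext smult (\<lambda>(m, y). Poly_Mapping.single y (mon_eval f m))" for f
  define slice :: "mon \<times> mon \<Rightarrow> (mon \<times> mon \<times> mon \<Rightarrow>\<^sub>0 'k) \<Rightarrow> 'k H"
    where "slice y = lin_ext smult (\<lambda>(m, y'). Poly_Mapping.single m (if y' = y then 1 else 0))" for y
  have "poly_fun2 (C f R) g h = poly_fun3 R f g h" for R f g h
    unfolding C_def poly_fun3_def linear_lin_ext_comp[OF linear_poly_fun2 vector_space_mult]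
    by (rule arg_cong[where f = "\<lambda>e. lin_ext (*) e R"])
       (auto simp: fun_eq_iff poly_fun2_def vector_space_mult)
  then have C: "C f P = C f Q" for f
    using assms by (intro poly_fun2_inject) simp
  have "poly_fun (slice y R) f = lookup (C f R) y" for y R f
    unfolding slice_def linear_lin_ext_comp[OF linear_poly_fun vector_space_mult]
    by (auto simp: lin_ext_def C_def lookup_sum lookup_single when_def intro!: sum.cong split: prod.splits)
  then have slice: "slice y P = slice y Q" for y
    using C by (intro poly_fun_inject) simp
  have "lookup (slice y R) m = lookup R (m, y)" for y R m
  proof -
    have "lookup (slice y R) m = (\<Sum>z\<in>keys R. if z = (m, y) then lookup R z else 0)"
      unfolding slice_def lin_ext_def lookup_sum
      by (intro sum.cong refl) (auto simp: lookup_single when_def split: prod.splits)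
    then show ?thesis
      by (simp add: in_keys_iff)
  qed
  then have "lookup P (m, y) = lookup Q (m, y)" for m y
    using slice[of y] by metis
  then show ?thesis
    by (intro poly_mapping_eqI) (simp add: split_paired_all)
qed

lemma lookup_tensor_assoc: "lookup (tensor_assoc R) (m, n, r) = lookup R ((m, n), r)"
proof -
  \<comment> \<open>\<open>map_key\<close> is described as precomposition for injective
    reindexings.\<close>
  have [transfer_rule]: "inj (\<lambda>(m, n, r). ((m, n), r))"
    by (auto simp: inj_def)
  show ?thesis
    unfolding tensor_assoc_def by transfer simp
qed

lemma tensor_assoc_single:
  "tensor_assoc (Poly_Mapping.single ((m, n), r) a) = Poly_Mapping.single (m, n, r) (a :: 'k::field)"
  by (rule poly_mapping_eqI) (simp add: split_paired_all lookup_tensor_assoc lookup_single when_def)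

lemma linear_tensor_assoc: "Vector_Spaces.linear smult smult tensor_assoc"
  by unfold_locales (auto intro!: poly_mapping_eqI simp: lookup_tensor_assoc lookup_add)

lemma poly_fun3_tensor_assoc:
  fixes R :: "(mon \<times> mon) \<times> mon \<Rightarrow>\<^sub>0 'k::field"
  shows "poly_fun3 (tensor_assoc R) f g h =
    lin_ext (*) (\<lambda>(x, r). (case x of (m, n) \<Rightarrow> mon_eval f m * mon_eval g n) * mon_eval h r) R"
proof (rule linear_eqI[of "(*)"])
  show "Vector_Spaces.linear smult (*) (\<lambda>R. poly_fun3 (tensor_assoc R) f g h)"
    unfolding poly_fun3_def
    by (rule linear_comp[OF linear_tensor_assoc linear_lin_ext]) (rule vector_space_mult)
qed (auto intro: linear_lin_ext vector_space_mult
    simp: poly_fun3_def vector_space_mult tensor_assoc_single mult.assoc split: prod.splits)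

section \<open>Coproduct, counit and antipode as duals of the group laws\<close>

lemma poly_fun2_coproduct:
  "poly_fun2 (coproduct p) f g = poly_fun p (compose f (g :: 'k::field_char_0 series))"
proof -
  note D = is_coproduct_coproduct[unfolded is_coproduct_def]
  \<comment> \<open>Both sides are algebra morphisms in \<open>p\<close> and agree on coordinates by
    the defining property of the coproduct.\<close>
  have "(\<lambda>p. poly_fun2 (coproduct p) f g) = (\<lambda>p. poly_fun p (compose f g))"
    by (rule algebra_hom_eqI[of "(*)"])
       (use D in \<open>auto intro: algebra_hom_comp algebra_hom_poly_fun2 algebra_hom_poly_fun\<close>)
  then show ?thesis by metis
qed

lemma poly_fun2_coproduct_single:
  "lin_ext (*) (\<lambda>(m, n). mon_eval f m * mon_eval g n) (coproduct (Poly_Mapping.single m 1)) =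
    mon_eval (compose f (g :: 'k::field_char_0 series)) m"
  using poly_fun2_coproduct[of "Poly_Mapping.single m 1" f g] by (simp add: poly_fun2_def)

text \<open>At three series, the two sides take the values of \<open>p\<close> at the two
  bracketings of their composition.\<close>

lemma coassociative_coproduct: "coassociative (coproduct :: 'k::field_char_0 H \<Rightarrow> _)"
  unfolding coassociative_def
proof (intro allI poly_fun3_inject)
  fix p :: "'k H" and f g h
  have "poly_fun3 (tensor_assoc (tensor_map coproduct id (coproduct p))) f g h =
      poly_fun2 (coproduct p) (compose f g) h"
    unfolding poly_fun3_tensor_assoc lin_ext_tensor_map
    by (simp add: poly_fun2_coproduct_single poly_fun2_def vector_space_mult)
  moreover have "poly_fun3 (tensor_map id coproduct (coproduct p)) f g h =
      poly_fun2 (coproduct p) f (compose g h)"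
    unfolding poly_fun3_def lin_ext_tensor_map
    by (simp add: poly_fun2_coproduct_single poly_fun2_def vector_space_mult)
  ultimately show "poly_fun3 (tensor_assoc (tensor_map coproduct id (coproduct p))) f g h =
      poly_fun3 (tensor_map id coproduct (coproduct p)) f g h"
    by (simp add: poly_fun2_coproduct compose_assoc)
qed

text \<open>The counit is evaluation at the zero series, the neutral element for
  composition.\<close>

lemma is_counit_coproduct:
  "is_counit coproduct (\<lambda>p :: 'k::field_char_0 H. poly_fun p (\<lambda>_. 0))"
  unfolding is_counit_def
proof (intro conjI allI poly_fun_inject)
  fix p :: "'k H" and f
  let ?s = "\<lambda>m :: mon. Poly_Mapping.single m (1 :: 'k)"
  have "poly_fun (lin_ext smult (\<lambda>(m, n). smult (poly_fun (?s m) (\<lambda>_. 0)) (?s n)) (coproduct p)) f =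
      poly_fun2 (coproduct p) (\<lambda>_. 0) f"
    unfolding linear_lin_ext_comp[OF linear_poly_fun vector_space_mult] poly_fun2_def
    by (simp add: split_def)
  then show "poly_fun (lin_ext smult (\<lambda>(m, n). smult (poly_fun (?s m) (\<lambda>_. 0)) (?s n)) (coproduct p)) f = poly_fun p f"
    by (simp only: poly_fun2_coproduct compose_zero_left)
  have "poly_fun (lin_ext smult (\<lambda>(m, n). smult (poly_fun (?s n) (\<lambda>_. 0)) (?s m)) (coproduct p)) f =
      poly_fun2 (coproduct p) f (\<lambda>_. 0)"
    unfolding linear_lin_ext_comp[OF linear_poly_fun vector_space_mult] poly_fun2_def
    by (simp add: split_def mult.commute)
  then show "poly_fun (lin_ext smult (\<lambda>(m, n). smult (poly_fun (?s n) (\<lambda>_. 0)) (?s m)) (coproduct p)) f = poly_fun p f"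
    by (simp only: poly_fun2_coproduct compose_zero_right)
qed

text \<open>Multiplication is dual to the diagonal embedding of series into pairs of series.\<close>

lemma poly_fun_mult_map: "poly_fun (mult_map P) f = poly_fun2 P f (f :: 'k::field series)"
  unfolding mult_map_def linear_lin_ext_comp[OF linear_poly_fun vector_space_mult] poly_fun2_def
  by (simp add: split_def mult_single mon_eval_add)

text \<open>The antipode is the algebra morphism dual to inversion: it sends each coordinate to a
  polynomial \<open>I c\<close> representing that coefficient of \<open>compose_inv\<close>.\<close>

lemma ex_antipode:
  "\<exists>S. is_antipode coproduct (\<lambda>p :: 'k::field_char_0 H. poly_fun p (\<lambda>_. 0)) S"
proof -
  have "\<exists>p :: 'k H. \<forall>f. poly_fun p f = compose_inv f c" for c
  proof -
    obtain P :: "'k HH" where "\<And>f g. poly_fun2 P f g = compose_inv f c"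
      using is_poly2_compose_inv[of c] unfolding is_poly2_def by blast
    \<comment> \<open>Restriction to the diagonal turns a polynomial in two series into a polynomial
      in one.\<close>
    then have "\<forall>f. poly_fun (mult_map P) f = compose_inv f c"
      by (simp add: poly_fun_mult_map)
    then show ?thesis ..
  qed
  then obtain I :: "word \<Rightarrow> 'k H" where I: "\<And>c f. poly_fun (I c) f = compose_inv f c"
    by metis
  define S where "S = lin_ext smult (mon_eval I)"
  have "(\<lambda>p. poly_fun (S p) f) = (\<lambda>p. poly_fun p (compose_inv f))" for f
    unfolding S_def
    by (rule algebra_hom_eqI[of "(*)"])
       (auto intro: algebra_hom_comp algebra_hom_lift algebra_hom_poly_fun simp: lift_coord I)
  then have S: "poly_fun (S p) f = poly_fun p (compose_inv f)" for p f
    by metis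
  have S': "lin_ext (*) (mon_eval f) (S (Poly_Mapping.single m 1)) = mon_eval (compose_inv f) m" for f m
    using S[of "Poly_Mapping.single m 1" f] by (simp add: poly_fun_def vector_space_mult)
  have one: "poly_fun 1 f = 1" for f :: "'k series"
    using poly_fun_single[of 0 1 f] by simp
  have eps: "poly_fun (smult a 1) f = a" for a and f :: "'k series"
  proof -
    interpret L: Vector_Spaces.linear smult "(*)" "\<lambda>p. poly_fun p f"
      by (rule linear_poly_fun)
    show ?thesis by (simp add: L.scale one)
  qed
  have "is_antipode coproduct (\<lambda>p. poly_fun p (\<lambda>_. 0)) S"
    unfolding is_antipode_def
  proof (intro conjI allI poly_fun_inject)
    show "Vector_Spaces.linear smult smult S"
      unfolding S_def by (rule linear_lin_ext[OF vector_space_smult])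
  next
    fix p :: "'k H" and f
    have "poly_fun (mult_map (tensor_map S id (coproduct p))) f = poly_fun2 (coproduct p) (compose_inv f) f"
      unfolding poly_fun_mult_map poly_fun2_def lin_ext_tensor_map by (simp add: S' vector_space_mult)
    then show "poly_fun (mult_map (tensor_map S id (coproduct p))) f = poly_fun (smult (poly_fun p (\<lambda>_. 0)) 1) f"
      by (simp add: poly_fun2_coproduct compose_inv_left eps)
  next
    fix p :: "'k H" and f
    have "poly_fun (mult_map (tensor_map id S (coproduct p))) f = poly_fun2 (coproduct p) f (compose_inv f)"
      unfolding poly_fun_mult_map poly_fun2_def lin_ext_tensor_map by (simp add: S' vector_space_mult)
    then show "poly_fun (mult_map (tensor_map id S (coproduct p))) f = poly_fun (smult (poly_fun p (\<lambda>_. 0)) 1) f"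
      by (simp add: poly_fun2_coproduct compose_inv_right eps)
  qed
  then show ?thesis by blast
qed

lemma hopf_algebra_coproduct: "hopf_algebra (coproduct :: 'k::field_char_0 H \<Rightarrow> _)"
  unfolding hopf_algebra_def
  using is_coproduct_coproduct coassociative_coproduct algebra_hom_poly_fun[of "\<lambda>_. 0 :: 'k"]
    is_counit_coproduct ex_antipode
  by (auto simp: is_coproduct_def)

section \<open>The gradation\<close>

definition mon_deg :: "mon \<Rightarrow> nat" where
  "mon_deg m = (\<Sum>c\<in>keys m. lookup m c * deg c)"

lemma mon_deg_superset:
  assumes "finite A" "keys m \<subseteq> A"
  shows "mon_deg m = (\<Sum>c\<in>A. lookup m c * deg c)"
  unfolding mon_deg_def
  by (rule sum.mono_neutral_left) (use assms in \<open>auto simp: in_keys_iff\<close>)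

lemma mon_deg_zero [simp]: "mon_deg 0 = 0"
  by (simp add: mon_deg_def)

lemma mon_deg_single [simp]: "mon_deg (Poly_Mapping.single c (Suc 0)) = deg c"
  by (simp add: mon_deg_def)

lemma mon_deg_add: "mon_deg (m + n) = mon_deg m + mon_deg n"
proof -
  have "mon_deg r = (\<Sum>c\<in>keys m \<union> keys n. lookup r c * deg c)" if "r \<in> {m, n, m + n}" for r
    by (rule mon_deg_superset) (use that keys_add[of m n] in auto)
  then show ?thesis
    by (simp add: lookup_add sum.distrib distrib_right)
qed

lemma deg_pos: "1 \<le> deg c"
  by (simp add: deg_def)

lemma mon_deg_eq_0_iff: "mon_deg m = 0 \<longleftrightarrow> m = 0"
proof
  assume m: "mon_deg m = 0"
  have "lookup m c = 0" for c
    using m deg_pos[of c] by (cases "c \<in> keys m") (auto simp: mon_deg_def in_keys_iff)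
  then show "m = 0" by (intro poly_mapping_eqI) simp
qed simp

text \<open>Coordinates are split off one at a time; each has positive degree, so the degree of the
  rest drops.\<close>

lemma single_eq_prod_list:
  "\<exists>ws. Poly_Mapping.single m (1 :: 'k::field) = prod_list (map coord ws) \<and> sum_list (map deg ws) = mon_deg m"
proof (induction "mon_deg m" arbitrary: m rule: less_induct)
  case less
  show ?case
  proof (cases "m = 0")
    case True
    then show ?thesis by (intro exI[of _ "[]"]) simp
  next
    case False
    then obtain c where c: "lookup m c \<noteq> 0"
      using poly_mapping_eqI[of m 0] by fastforce
    define n where "n = m - Poly_Mapping.single c 1"
    \<comment> \<open>Subtraction of exponents is truncated, but exact here because \<open>c\<close>
      occurs in \<open>m\<close>.\<close>
    have m: "m = Poly_Mapping.single c 1 + n"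
      using c by (intro poly_mapping_eqI) (auto simp: n_def lookup_add lookup_minus lookup_single when_def)
    then have d: "mon_deg m = deg c + mon_deg n"
      by (simp add: mon_deg_add)
    then obtain ws where "Poly_Mapping.single n (1 :: 'k) = prod_list (map coord ws)" "sum_list (map deg ws) = mon_deg n"
      using less[of n] deg_pos[of c] by auto
    moreover have "Poly_Mapping.single m (1 :: 'k) = coord c * Poly_Mapping.single n 1"
      by (simp add: coord_def mult_single m)
    ultimately show ?thesis
      using d by (intro exI[of _ "c # ws"]) simp
  qed
qed

section \<open>Graded pieces as spans of monomials\<close>

definition supported_on :: "'m set \<Rightarrow> ('m \<Rightarrow>\<^sub>0 'k::field) set" where
  "supported_on A = {p. keys p \<subseteq> A}"

lemma supported_onD: "p \<in> supported_on A \<Longrightarrow> lookup p m \<noteq> 0 \<Longrightarrow> m \<in> A"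
  by (auto simp: supported_on_def in_keys_iff)

lemma supported_onI: "(\<And>m. lookup p m \<noteq> 0 \<Longrightarrow> m \<in> A) \<Longrightarrow> p \<in> supported_on A"
  by (auto simp: supported_on_def in_keys_iff)

lemma subspace_supported_on: "pm.subspace (supported_on A)"
proof (rule pm.subspaceI)
  show "p + q \<in> supported_on A" if "p \<in> supported_on A" "q \<in> supported_on A" for p q
    using that keys_add[of p q] by (auto simp: supported_on_def)
qed (auto simp: supported_on_def in_keys_iff)

lemma supported_on_subset_span:
  assumes "\<And>m. m \<in> A \<Longrightarrow> Poly_Mapping.single m 1 \<in> B"
  shows "supported_on A \<subseteq> pm.span (B :: ('m \<Rightarrow>\<^sub>0 'k::field) set)"
proof
  fix p :: "'m \<Rightarrow>\<^sub>0 'k"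
  assume "p \<in> supported_on A"
  then have "(\<Sum>m\<in>keys p. smult (lookup p m) (Poly_Mapping.single m 1)) \<in> pm.span B"
    by (intro pm.span_sum pm.span_scale pm.span_base assms) (auto simp: supported_on_def)
  then show "p \<in> pm.span B"
    using pm_expand[of p] by simp
qed

lemma supported_on_mult:
  assumes "p \<in> supported_on A" "q \<in> supported_on B"
  shows "p * q \<in> supported_on {m + n |m n. m \<in> A \<and> n \<in> B}"
  using assms keys_mult[of p q] unfolding supported_on_def by blast

lemma V_grade_subset: "V_grade k \<subseteq> supported_on {m. mon_deg m = k}"
  unfolding V_grade_def
  by (rule pm.span_minimal[OF _ subspace_supported_on]) (auto simp: coord_def supported_on_def)

text \<open>Degrees add in products, which gives one inclusion; factoring monomials into coordinates
  gives the other. Membership in a graded piece thus becomes a condition on coefficients.\<close>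

lemma H_grade_eq: "H_grade n = (supported_on {m. mon_deg m = n} :: 'k::field H set)"
proof
  have "prod_list vs \<in> supported_on {m. mon_deg m = sum_list ks}"
    if "list_all2 (\<lambda>v k. 1 \<le> k \<and> v \<in> V_grade k) vs ks" for vs :: "'k H list" and ks
    using that
  proof induction
    case Nil
    then show ?case by (auto simp: supported_on_def)
  next
    case (Cons v vs k ks)
    then have "v * prod_list vs \<in> supported_on {m + n |m n. m \<in> {m. mon_deg m = k} \<and> n \<in> {m. mon_deg m = sum_list ks}}"
      using V_grade_subset by (intro supported_on_mult) auto
    then show ?case
      by (auto simp: supported_on_def mon_deg_add)
  qed
  then show "H_grade n \<subseteq> (supported_on {m. mon_deg m = n} :: 'k H set)"
    unfolding H_grade_def by (intro pm.span_minimal subspace_supported_on) auto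
  show "supported_on {m. mon_deg m = n} \<subseteq> (H_grade n :: 'k H set)"
    unfolding H_grade_def
  proof (rule supported_on_subset_span)
    fix m assume m: "m \<in> {m. mon_deg m = n}"
    obtain ws where ws: "Poly_Mapping.single m (1 :: 'k) = prod_list (map coord ws)" "sum_list (map deg ws) = mon_deg m"
      using single_eq_prod_list by blast
    have "list_all2 (\<lambda>v k. 1 \<le> k \<and> v \<in> V_grade k) (map coord ws :: 'k H list) (map deg ws)"
      by (auto simp: list_all2_conv_all_nth V_grade_def deg_pos[simplified] intro!: pm.span_base)
    with ws m show "Poly_Mapping.single m 1 \<in>
        {prod_list vs |vs ks. list_all2 (\<lambda>v k. 1 \<le> k \<and> (v :: 'k H) \<in> V_grade k) vs ks \<and> sum_list ks = n}"
      by auto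
  qed
qed

lemma direct_sum_decomposition_supported_on:
  fixes d :: "'m \<Rightarrow> nat"
  shows "direct_sum_decomposition (\<lambda>n. supported_on {m. d m = n} :: ('m \<Rightarrow>\<^sub>0 'k::field) set)"
  unfolding direct_sum_decomposition_def
proof (intro conjI allI)
  fix p :: "'m \<Rightarrow>\<^sub>0 'k"
  let ?G = "\<lambda>n. supported_on {m. d m = n} :: ('m \<Rightarrow>\<^sub>0 'k) set"
  \<comment> \<open>A monomial \<open>m\<close> can occur only in the component of index
    \<open>d m\<close>. Both existence and uniqueness of the decomposition rest on this.\<close>
  have lookup: "lookup (\<Sum>n. g n) m = lookup (g (d m)) m"
    if g: "\<forall>n. g n \<in> ?G n" "finite {n. g n \<noteq> 0}" for g m
  proof -
    have "lookup (\<Sum>n. g n) m = (\<Sum>n\<in>{n. g n \<noteq> 0}. lookup (g n) m)"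
      by (simp add: Sum_any.expand_set lookup_sum)
    also have "\<dots> = (\<Sum>n\<in>{n. g n \<noteq> 0}. if n = d m then lookup (g n) m else 0)"
      using g(1) by (intro sum.cong refl) (auto dest: supported_onD)
    finally show ?thesis
      using g(2) by auto
  qed
  define c where "c n = (\<Sum>m\<in>{m\<in>keys p. d m = n}. Poly_Mapping.single m (lookup p m))" for n
  have c: "lookup (c n) m = (if d m = n then lookup p m else 0)" for n m
    by (auto simp: c_def lookup_sum lookup_single when_def in_keys_iff)
  show "\<exists>!g. (\<forall>n. g n \<in> ?G n) \<and> finite {n. g n \<noteq> 0} \<and> p = (\<Sum>n. g n)"
  proof (rule ex1I[of _ c])
    have fin: "finite {n. c n \<noteq> 0}"
    proof (rule finite_subset)
      show "{n. c n \<noteq> 0} \<subseteq> d ` keys p"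
      proof clarify
        fix n
        assume "c n \<noteq> 0"
        then have "{m\<in>keys p. d m = n} \<noteq> {}"
          unfolding c_def by (metis sum.empty)
        then show "n \<in> d ` keys p" by blast
      qed
    qed simp
    moreover have mem: "\<forall>n. c n \<in> ?G n"
      by (auto intro!: supported_onI simp: c split: if_splits)
    moreover have "p = (\<Sum>n. c n)"
      by (rule poly_mapping_eqI) (simp add: lookup[OF mem fin] c)
    ultimately show "(\<forall>n. c n \<in> ?G n) \<and> finite {n. c n \<noteq> 0} \<and> p = (\<Sum>n. c n)"
      by blast
  next
    fix g
    assume g: "(\<forall>n. g n \<in> ?G n) \<and> finite {n. g n \<noteq> 0} \<and> p = (\<Sum>n. g n)"
    show "g = c"
    proof (intro ext poly_mapping_eqI)
      fix n m
      have "lookup p m = lookup (g (d m)) m"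
        using g lookup[of g m] by simp
      then show "lookup (g n) m = lookup (c n) m"
        using g supported_onD[of "g n" "{m. d m = n}" m] by (auto simp: c)
    qed
  qed
qed (rule subspace_supported_on)

text \<open>Words have positive degree, so only the trivial monomial has degree 0.\<close>

lemma H_grade_0: "(H_grade 0 :: 'k::field H set) = range (\<lambda>a. smult a 1)"
proof -
  have "p = smult (lookup p 0) 1" if "p \<in> supported_on {0}" for p :: "'k H"
    using that by (intro poly_mapping_eqI) (auto dest: supported_onD simp: lookup_one when_def)
  moreover have "smult a 1 \<in> (supported_on {0} :: 'k H set)" for a
    by (auto intro!: supported_onI simp: lookup_one when_def split: if_splits)
  ultimately show ?thesis
    unfolding H_grade_eq mon_deg_eq_0_iff by auto
qed

lemma H_grade_mult: "p \<in> H_grade i \<Longrightarrow> q \<in> H_grade j \<Longrightarrow> p * q \<in> (H_grade (i + j) :: 'k::field H set)"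
  unfolding H_grade_eq using supported_on_mult[of p _ q] by (fastforce simp: supported_on_def mon_deg_add)

lemma supported_on_subset_tensor_grade:
  "supported_on {(m, m'). mon_deg m + mon_deg m' = n} \<subseteq> (tensor_grade H_grade n :: 'k::field HH set)"
  unfolding tensor_grade_def
proof (rule supported_on_subset_span, clarify)
  fix m m' assume "n = mon_deg m + mon_deg m'"
  moreover have "Poly_Mapping.single (m, m') (1 :: 'k) = tensor (Poly_Mapping.single m 1) (Poly_Mapping.single m' 1)"
    by (rule poly_mapping_eqI) (simp add: split_paired_all lookup_tensor lookup_single when_def)
  ultimately show "\<exists>p q i j. Poly_Mapping.single (m, m') (1 :: 'k) = tensor p q \<and>
      i + j = mon_deg m + mon_deg m' \<and> p \<in> H_grade i \<and> q \<in> H_grade j"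
    by (intro exI[of _ "Poly_Mapping.single m 1"] exI[of _ "Poly_Mapping.single m' 1"]
        exI[of _ "mon_deg m"] exI[of _ "mon_deg m'"]) (simp add: H_grade_eq supported_on_def)
qed

section \<open>Homogeneity of the coproduct\<close>

text \<open>The one-parameter group of automorphisms of the group of series that defines the gradation.\<close>

definition scale_series :: "'k::comm_semiring_1 \<Rightarrow> 'k series \<Rightarrow> 'k series" where
  "scale_series t f c = t ^ deg c * f c"

lemma deg_eq_filter: "deg c = length c + 1 + length (filter (\<lambda>b. b = x0) c)"
  by (simp add: deg_def length_filter_conv_card)

lemma deg_Nil [simp]: "deg [] = 1"
  by (simp add: deg_eq_filter)

lemma deg_Cons [simp]: "deg (a # c) = deg c + (if a = x0 then 2 else 1)"
  by (simp add: deg_eq_filter)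

lemma scale_series_Cons:
  "deriv a (scale_series t f) = (\<lambda>u. t ^ (if a = x0 then 2 else 1) * scale_series t (deriv a f) u)"
  by (simp add: scale_series_def fun_eq_iff power_add mult_ac)

text \<open>The extra factor \<open>t\<close> comes from the \<open>+ 1\<close> in
  \<open>deg\<close>, counted once in each factor but only once in their shuffle: the degrees of two
  words add up to one more than that of any shuffle of them.\<close>

lemma shuffle_scale_series:
  "shuffle (scale_series t f) (scale_series t g) w = t * scale_series t (shuffle f g) w"
proof (induction w arbitrary: f g)
  case Nil
  then show ?case by (simp add: scale_series_def mult_ac)
next
  case (Cons a w)
  let ?e = "if a = x0 then 2 else 1 :: nat"
  have "shuffle (scale_series t f) (scale_series t g) (a # w) =
      t ^ ?e * (t * scale_series t (shuffle (deriv a f) g) w)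
      + t ^ ?e * (t * scale_series t (shuffle f (deriv a g)) w)"
    by (simp only: shuffle_Cons scale_series_Cons shuffle_scale_left shuffle_scale_right Cons)
  also have "\<dots> = t * scale_series t (shuffle f g) (a # w)"
    unfolding scale_series_def deg_Cons shuffle_Cons by (simp add: power_add distrib_left mult_ac)
  finally show ?case .
qed

lemma act_scale_series: "act (scale_series t d) (scale_series t c) w = scale_series t (act d c) w"
proof (induction "length w" arbitrary: w c rule: less_induct)
  case less
  show ?case
  proof (cases w)
    case Nil
    then show ?thesis by (simp add: scale_series_def)
  next
    case (Cons a u)
    have IH: "act (scale_series t d) (scale_series t c') u = scale_series t (act d c') u" for c'
      by (rule less) (simp add: Cons)
    have IH_shuffle: "shuffle (scale_series t d) (act (scale_series t d) (scale_series t c')) u =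
        t * scale_series t (shuffle d (act d c')) u" for c'
    proof -
      have "shuffle (scale_series t d) (act (scale_series t d) (scale_series t c')) u =
          shuffle (scale_series t d) (scale_series t (act d c')) u"
        by (rule shuffle_cong) (simp_all add: less Cons)
      then show ?thesis by (simp only: shuffle_scale_series)
    qed
    have act_deriv: "act (scale_series t d) (deriv b (scale_series t c)) v =
        t ^ (if b = x0 then 2 else 1) * act (scale_series t d) (scale_series t (deriv b c)) v" for b v
      by (simp only: scale_series_Cons act_scale)
    show ?thesis
    proof (cases a)
      case x0
      \<comment> \<open>Both contributions have weight \<open>t ^ 2\<close>: the letter
        \<open>x0\<close> gives it directly, while in the other term \<open>x1\<close> gives one
        \<open>t\<close> and the shuffle with \<open>d\<close> another. Hence \<open>x0\<close> must
        count twice in \<open>deg\<close>.\<close>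
      have "act (scale_series t d) (scale_series t c) w =
          t ^ 2 * scale_series t (act d (deriv x0 c)) u
          + t * (t * scale_series t (shuffle d (act d (deriv x1 c))) u)"
        by (simp only: Cons x0 act_Cons_x0 act_deriv[abs_def] shuffle_scale_right IH IH_shuffle)
          simp
      also have "\<dots> = scale_series t (act d c) w"
        unfolding Cons x0 scale_series_def deg_Cons
        by (simp add: power_add power2_eq_square distrib_left mult_ac)
      finally show ?thesis .
    next
      case x1
      then show ?thesis
        by (simp only: Cons x1 act_Cons_x1 act_deriv IH) (simp add: scale_series_def mult_ac)
    qed
  qed
qed

lemma compose_scale_series: "compose (scale_series t f) (scale_series t g) = scale_series t (compose f g)"
  unfolding compose_eq act_scale_series by (simp add: scale_series_def fun_eq_iff distrib_left)

lemma mon_eval_scale_series: "mon_eval (scale_series t f) m = t ^ mon_deg m * mon_eval f m"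
proof -
  have "mon_eval (scale_series t f) m = (\<Prod>c\<in>keys m. t ^ (lookup m c * deg c) * f c ^ lookup m c)"
    unfolding mon_eval_def
    by (rule prod.cong) (simp_all add: scale_series_def power_mult_distrib mult.commute[of "lookup m _"] power_mult)
  then show ?thesis
    by (simp add: mon_deg_def power_sum mon_eval_def prod.distrib)
qed

text \<open>Evaluating \<open>coproduct p\<close> at series scaled by 2 multiplies the whole value
  by \<open>2 ^ n\<close>, but the term of \<open>(m, m')\<close> by 2 to the power of its own
  degree. Comparing coefficients forces these degrees to agree.\<close>

lemma coproduct_H_grade:
  fixes p :: "'k::field_char_0 H"
  assumes "p \<in> H_grade n"
  shows "coproduct p \<in> supported_on {(m, m'). mon_deg m + mon_deg m' = n}"
proof (rule supported_onI, clarify)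
  fix m m'
  assume nz: "lookup (coproduct p) (m, m') \<noteq> 0"
  \<comment> \<open>\<open>Q\<close> weights each term so that its value at \<open>(f, g)\<close> is
    that of \<open>coproduct p\<close> at the scaled pair.\<close>
  define Q where "Q = lin_ext smult (\<lambda>(m, m'). Poly_Mapping.single (m, m') ((2::'k) ^ (mon_deg m + mon_deg m'))) (coproduct p)"
  have "poly_fun2 Q f g = poly_fun2 (smult (2 ^ n) (coproduct p)) f g" for f g
  proof -
    interpret L: Vector_Spaces.linear smult "(*)" "\<lambda>P. poly_fun2 P f g"
      by (rule linear_poly_fun2)
    have "poly_fun2 Q f g = poly_fun2 (coproduct p) (scale_series 2 f) (scale_series 2 g)"
      unfolding Q_def linear_lin_ext_comp[OF linear_poly_fun2 vector_space_mult]
        poly_fun2_def[of "coproduct p"]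
    proof (rule arg_cong[where f = "\<lambda>e. lin_ext (*) e (coproduct p)"], rule ext, clarify)
      fix m m'
      show "poly_fun2 (Poly_Mapping.single (m, m') (2 ^ (mon_deg m + mon_deg m'))) f g =
          mon_eval (scale_series 2 f) m * mon_eval (scale_series 2 g) m'"
        unfolding poly_fun2_def lin_ext_single[OF vector_space_mult] mon_eval_scale_series power_add prod.case
        by (simp only: mult_ac)
    qed
    also have "\<dots> = poly_fun p (scale_series 2 (compose f g))"
      by (simp add: poly_fun2_coproduct compose_scale_series)
    also have "\<dots> = 2 ^ n * poly_fun p (compose f g)"
    proof -
      have "mon_deg m = n" if "m \<in> keys p" for m
        using assms that by (auto simp: H_grade_eq supported_on_def)
      then show ?thesis
        unfolding poly_fun_def lin_ext_def sum_distrib_left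
        by (intro sum.cong refl) (simp add: mon_eval_scale_series)
    qed
    finally show ?thesis
      by (simp add: L.scale poly_fun2_coproduct)
  qed
  then have "Q = smult (2 ^ n) (coproduct p)"
    by (rule poly_fun2_inject)
  moreover have "lookup Q (m, m') = 2 ^ (mon_deg m + mon_deg m') * lookup (coproduct p) (m, m')"
  proof -
    have "lookup Q (m, m') = (\<Sum>z\<in>keys (coproduct p).
        if z = (m, m') then 2 ^ (mon_deg m + mon_deg m') * lookup (coproduct p) z else 0)"
      unfolding Q_def lin_ext_def lookup_sum
      by (intro sum.cong refl) (auto simp: lookup_single when_def split: prod.splits)
    then show ?thesis
      using nz by (simp add: in_keys_iff)
  qed
  ultimately have "(2::'k) ^ (mon_deg m + mon_deg m') * lookup (coproduct p) (m, m') =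
      2 ^ n * lookup (coproduct p) (m, m')"
    by (simp only: lookup_smult)
  then have "(2::'k) ^ (mon_deg m + mon_deg m') = 2 ^ n"
    using nz by (simp only: mult_cancel_right simp_thms)
  \<comment> \<open>In characteristic zero the equation descends to natural numbers, where the
    exponents can be compared.\<close>
  then have "of_nat (2 ^ (mon_deg m + mon_deg m')) = (of_nat (2 ^ n) :: 'k)"
    by (simp only: of_nat_power of_nat_numeral)
  then have "(2::nat) ^ (mon_deg m + mon_deg m') = 2 ^ n"
    by (simp only: of_nat_eq_iff)
  then show "mon_deg m + mon_deg m' = n"
    by simp
qed

theorem proposition7:
  shows "hopf_algebra (coproduct :: 'k::field_char_0 H \<Rightarrow> 'k HH) \<and>
    direct_sum_decomposition (H_grade :: nat \<Rightarrow> 'k H set) \<and>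
    (H_grade 0 :: 'k H set) = range (\<lambda>a. smult a 1) \<and>
    (\<forall>i j. \<forall>p \<in> H_grade i. \<forall>q \<in> H_grade j. (p * q :: 'k H) \<in> H_grade (i + j)) \<and>
    (\<forall>n. (coproduct :: 'k H \<Rightarrow> 'k HH) ` H_grade n \<subseteq> tensor_grade H_grade n)"
proof (intro conjI allI ballI)
  show "direct_sum_decomposition (H_grade :: nat \<Rightarrow> 'k H set)"
    using direct_sum_decomposition_supported_on[of mon_deg] by (simp add: H_grade_eq[abs_def])
  show "(coproduct :: 'k H \<Rightarrow> 'k HH) ` H_grade n \<subseteq> tensor_grade H_grade n" for n
    using coproduct_H_grade[of _ n] supported_on_subset_tensor_grade[of n] by fast
qed (simp_all add: hopf_algebra_coproduct H_grade_0 H_grade_mult)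

end
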